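(* Let $M$ be a compact connected complex manifold of complex dimension $n\ge 2$, let $\omega,\chi$ be Hermitian metrics on $M$, and let $F\in C^\infty(M,\mathbb R)$. For $t\ge0$ let $$\mathcal D_t:=\{[\varphi_0]\in\mathcal H_\chi/\mathbb R:\ \text{the solution of }\partial_t\varphi=\mathcal Q_F(\varphi),\ \varphi(\cdot,0)=\varphi_0,\ \text{exists on }[0,t]\}.$$ Then the solution map $$S_t:\mathcal D_t\to\mathcal H_\chi/\mathbb R,\qquad S_t[\varphi_0]=[\varphi(t)],$$ is well defined (both $\mathcal D_t$ and $S_t$ are independent of the choice of representatives) and is nonexpansive: $$d_{\mathrm{osc}}(S_t[\varphi_0],S_t[\psi_0])\le d_{\mathrm{osc}}([\varphi_0],[\psi_0])\qquad\text{for all }[\varphi_0],[\psi_0]\in\mathcal D_t.$$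
   Context: Hermitian metrics are identified with their positive real $(1,1)$-forms; no closedness is assumed. $\mathcal H_\chi=\{\varphi\in C^\infty(M,\mathbb R):\chi_\varphi:=\chi+\sqrt{-1}\,\partial\bar\partial\varphi>0\}$. For $\varphi\in\mathcal H_\chi$, $$\mathcal Q_F(\varphi)=\log\frac{\chi_\varphi^n}{\omega\wedge\chi_\varphi^{n-1}}+F=\log n-\log\operatorname{tr}_{\chi_\varphi}\omega+F.$$ Solutions are smooth and admissible, i.e. $\varphi(\cdot,t)\in\mathcal H_\chi$ for every $t$; for each $\varphi_0\in\mathcal H_\chi$ there is a unique such solution on a maximal interval $[0,T_{\max})$. $\mathcal H_\chi/\mathbb R$ is the quotient of $\mathcal H_\chi$ by addition of real constants, with the metric $d_{\mathrm{osc}}([\varphi],[\psi])=\operatorname{osc}_M(\varphi-\psi)$, where $\operatorname{osc}_Mf=\sup_Mf-\inf_Mf$. *)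

theory Defs
  imports "HOL-Analysis.Analysis"
begin

section \<open>Smooth and holomorphic maps between Euclidean spaces\<close>

fun Ck_on :: "nat \<Rightarrow> 'e::real_normed_vector set \<Rightarrow> ('e \<Rightarrow> 'f::real_normed_vector) \<Rightarrow> bool" where
  "Ck_on 0 W f \<longleftrightarrow> continuous_on W f"
| "Ck_on (Suc k) W f \<longleftrightarrow>
     (\<forall>x\<in>W. f differentiable (at x)) \<and> (\<forall>v. Ck_on k W (\<lambda>x. frechet_derivative f (at x) v))"

text \<open>Smoothness on an arbitrary set means local extendability to a smooth function on an open
  set. On open sets this is ordinary smoothness; on \<open>[0,t] \<times> V\<close> it is smoothness up to the boundary
  in the time variable, and it stays meaningful for \<open>t = 0\<close>.\<close>

definition smooth_on :: "'e::real_normed_vector set \<Rightarrow> ('e \<Rightarrow> 'f::real_normed_vector) \<Rightarrow> bool" where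
  "smooth_on S f \<longleftrightarrow>
     (\<forall>q\<in>S. \<exists>W g. open W \<and> q \<in> W \<and> (\<forall>k. Ck_on k W g) \<and> (\<forall>y\<in>S \<inter> W. g y = f y))"

definition holo_map_on :: "(complex^'n) set \<Rightarrow> (complex^'n \<Rightarrow> complex^'m) \<Rightarrow> bool" where
  "holo_map_on S f \<longleftrightarrow>
     (\<forall>z\<in>S. \<exists>L. (f has_derivative L) (at z) \<and> (\<forall>c v. L (c *s v) = c *s L v))"

text \<open>The Wirtinger operators \<open>\<partial>/\<partial>z_j\<close> and \<open>\<partial>/\<partial>\<bar>z_j\<close>; \<open>axis j 1\<close> and \<open>axis j \<i>\<close> are the real
  coordinate directions \<open>x_j\<close> and \<open>y_j\<close>.\<close>

definition wirt :: "'n::finite \<Rightarrow> (complex^'n \<Rightarrow> complex) \<Rightarrow> complex^'n \<Rightarrow> complex" where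
  "wirt j f z = (frechet_derivative f (at z) (axis j 1)
                 - \<i> * frechet_derivative f (at z) (axis j \<i>)) / 2"

definition wirt_bar :: "'n::finite \<Rightarrow> (complex^'n \<Rightarrow> complex) \<Rightarrow> complex^'n \<Rightarrow> complex" where
  "wirt_bar j f z = (frechet_derivative f (at z) (axis j 1)
                     + \<i> * frechet_derivative f (at z) (axis j \<i>)) / 2"

section \<open>Complex manifolds\<close>

text \<open>The manifold is the whole type \<open>'a\<close>; a chart is a pair of its domain and its coordinate map.
  A complex structure is given by any holomorphic atlas, not necessarily a maximal one.\<close>

type_synonym ('a, 'n) chart = "'a set \<times> ('a \<Rightarrow> complex^'n)"

definition chart_inv :: "('a, 'n) chart \<Rightarrow> complex^'n \<Rightarrow> 'a" where
  "chart_inv c = inv_into (fst c) (snd c)"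

definition chart_image :: "('a, 'n) chart \<Rightarrow> (complex^'n) set" where
  "chart_image c = snd c ` fst c"

definition holomorphic_atlas :: "('a::t2_space, 'n::finite) chart set \<Rightarrow> bool" where
  "holomorphic_atlas A \<longleftrightarrow>
     (\<Union>c\<in>A. fst c) = UNIV \<and>
     (\<forall>c\<in>A. open (fst c) \<and> open (chart_image c) \<and>
        homeomorphism (fst c) (chart_image c) (snd c) (chart_inv c)) \<and>
     (\<forall>c\<in>A. \<forall>d\<in>A. holo_map_on (snd c ` (fst c \<inter> fst d)) (snd d \<circ> chart_inv c))"

definition smooth_fun :: "('a::t2_space, 'n::finite) chart set \<Rightarrow> ('a \<Rightarrow> real) \<Rightarrow> bool" where
  "smooth_fun A f \<longleftrightarrow> (\<forall>c\<in>A. smooth_on (chart_image c) (f \<circ> chart_inv c))"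

section \<open>Real (1,1)-forms and Hermitian metrics\<close>

text \<open>A (1,1)-form is given by its coefficients in the charts of the atlas:
  \<open>\<alpha> c p $ j $ k\<close> is the coefficient \<open>\<alpha>_{j\<bar>k}\<close> in \<open>\<alpha> = \<i> \<Sum> \<alpha>_{j\<bar>k} dz_j \<and> d\<bar>z_k\<close> at the point \<open>p\<close>, where
  \<open>z\<close> are the coordinates of the chart \<open>c\<close>. Values at points outside the domain of \<open>c\<close>, or at
  charts outside the atlas, are irrelevant.\<close>

type_synonym ('a, 'n) form11 = "('a, 'n) chart \<Rightarrow> 'a \<Rightarrow> complex^'n^'n"

text \<open>\<open>transition_jac c d p $ a $ j\<close> is \<open>\<partial>w_a/\<partial>z_j\<close> at \<open>p\<close> for the coordinates \<open>z\<close> of \<open>c\<close> and \<open>w\<close> of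
  \<open>d\<close>.\<close>

definition transition_jac ::
  "('a, 'n::finite) chart \<Rightarrow> ('a, 'n) chart \<Rightarrow> 'a \<Rightarrow> complex^'n^'n" where
  "transition_jac c d p =
     (\<chi> a j. frechet_derivative (snd d \<circ> chart_inv c) (at (snd c p)) (axis j 1) $ a)"

definition real_11_form :: "('a::t2_space, 'n::finite) chart set \<Rightarrow> ('a, 'n) form11 \<Rightarrow> bool" where
  "real_11_form A \<alpha> \<longleftrightarrow>
     (\<forall>c\<in>A. smooth_on (chart_image c) (\<alpha> c \<circ> chart_inv c)) \<and>
     (\<forall>c\<in>A. \<forall>p\<in>fst c. \<forall>j k. \<alpha> c p $ k $ j = cnj (\<alpha> c p $ j $ k)) \<and>
     (\<forall>c\<in>A. \<forall>d\<in>A. \<forall>p\<in>fst c \<inter> fst d. \<forall>j k.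
        \<alpha> c p $ j $ k =
          (\<Sum>a\<in>UNIV. \<Sum>b\<in>UNIV. \<alpha> d p $ a $ b * transition_jac c d p $ a $ j
                                  * cnj (transition_jac c d p $ b $ k)))"

text \<open>For the forms considered here the sum below is automatically real.\<close>

definition positive_form :: "('a::t2_space, 'n::finite) chart set \<Rightarrow> ('a, 'n) form11 \<Rightarrow> bool" where
  "positive_form A \<alpha> \<longleftrightarrow>
     (\<forall>c\<in>A. \<forall>p\<in>fst c. \<forall>v. v \<noteq> 0 \<longrightarrow>
        0 < Re (\<Sum>j\<in>UNIV. \<Sum>k\<in>UNIV. \<alpha> c p $ j $ k * v $ j * cnj (v $ k)))"

definition hermitian_metric :: "('a::t2_space, 'n::finite) chart set \<Rightarrow> ('a, 'n) form11 \<Rightarrow> bool" where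
  "hermitian_metric A \<alpha> \<longleftrightarrow> real_11_form A \<alpha> \<and> positive_form A \<alpha>"

text \<open>The form \<open>\<i> \<partial>\<bar>\<partial> \<phi>\<close>, whose coefficients are \<open>\<partial>\<^sup>2\<phi>/\<partial>z_j\<partial>\<bar>z_k\<close>.\<close>

definition i_ddbar :: "('a \<Rightarrow> real) \<Rightarrow> ('a, 'n::finite) form11" where
  "i_ddbar \<phi> c p =
     (\<chi> j k. wirt j (wirt_bar k (\<lambda>z. complex_of_real (\<phi> (chart_inv c z)))) (snd c p))"

definition form_plus :: "('a, 'n::finite) form11 \<Rightarrow> ('a \<Rightarrow> real) \<Rightarrow> ('a, 'n) form11" where
  "form_plus chi \<phi> c p = chi c p + i_ddbar \<phi> c p"

definition potentials ::
  "('a::t2_space, 'n::finite) chart set \<Rightarrow> ('a, 'n) form11 \<Rightarrow> ('a \<Rightarrow> real) set" where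
  "potentials A chi = {\<phi>. smooth_fun A \<phi> \<and> positive_form A (form_plus chi \<phi>)}"

section \<open>Top exterior products and the operator\<close>

text \<open>For \<open>\<alpha>_k = \<i> \<Sum> (X k)_{ab} dz_a \<and> d\<bar>z_b\<close>, one for each of the \<open>n\<close> indices \<open>k\<close>, the exterior
  product of all \<open>\<alpha>_k\<close> equals \<open>wedge_top X\<close> times the product of all \<open>\<i> dz_k \<and> d\<bar>z_k\<close>: in the expansion
  only the terms with \<open>a = \<sigma> k\<close>, \<open>b = \<tau> k\<close> for permutations \<open>\<sigma>\<close>, \<open>\<tau>\<close> survive, and reordering the \<open>dz\<close>
  and the \<open>d\<bar>z\<close> yields the two signs.\<close>

definition wedge_top :: "('n::finite \<Rightarrow> complex^'n^'n) \<Rightarrow> complex" where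
  "wedge_top X =
     (\<Sum>\<sigma> | \<sigma> permutes UNIV. \<Sum>\<tau> | \<tau> permutes UNIV.
        of_int (sign \<sigma>) * of_int (sign \<tau>) * (\<Prod>k\<in>UNIV. X k $ \<sigma> k $ \<tau> k))"

definition wedge_power :: "complex^'n^'n \<Rightarrow> complex" where
  "wedge_power G = wedge_top (\<lambda>k::'n::finite. G)"

text \<open>\<open>\<omega> \<and> \<chi>\<^sup>n\<^sup>-\<^sup>1\<close>. Forms of degree two commute, so the slot taken by the first factor is
  immaterial.\<close>

definition wedge_power1 :: "complex^'n^'n \<Rightarrow> complex^'n^'n \<Rightarrow> complex" where
  "wedge_power1 W G = wedge_top ((\<lambda>k::'n::finite. G)((SOME k. True) := W))"

text \<open>The ratio of two top forms does not depend on the chart in which it is computed;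
  below, the flow equation is required in every chart.\<close>

definition Q_op ::
  "('a, 'n::finite) form11 \<Rightarrow> ('a, 'n) form11 \<Rightarrow> ('a \<Rightarrow> real) \<Rightarrow> ('a \<Rightarrow> real)
     \<Rightarrow> ('a, 'n) chart \<Rightarrow> 'a \<Rightarrow> real" where
  "Q_op \<omega> chi F \<phi> c p =
     ln (Re (wedge_power (form_plus chi \<phi> c p) / wedge_power1 (\<omega> c p) (form_plus chi \<phi> c p))) + F p"

section \<open>The flow, the quotient by constants, and the solution map\<close>

definition flow_solution ::
  "('a::t2_space, 'n::finite) chart set \<Rightarrow> ('a, 'n) form11 \<Rightarrow> ('a, 'n) form11 \<Rightarrow> ('a \<Rightarrow> real)
     \<Rightarrow> real set \<Rightarrow> (real \<Rightarrow> 'a \<Rightarrow> real) \<Rightarrow> bool" where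
  "flow_solution A \<omega> chi F I \<phi> \<longleftrightarrow>
     (\<forall>c\<in>A. smooth_on (I \<times> chart_image c) (\<lambda>(s, z). \<phi> s (chart_inv c z))) \<and>
     (\<forall>s\<in>I. \<phi> s \<in> potentials A chi) \<and>
     (\<forall>s\<in>I. \<forall>c\<in>A. \<forall>p\<in>fst c.
        ((\<lambda>r. \<phi> r p) has_real_derivative Q_op \<omega> chi F (\<phi> s) c p) (at s within I))"

text \<open>A solution on \<open>[0,t]\<close> exists iff \<open>t\<close> is smaller than the maximal existence time of the solution
  starting at \<open>\<phi>0\<close>.\<close>

definition flow_exists ::
  "('a::t2_space, 'n::finite) chart set \<Rightarrow> ('a, 'n) form11 \<Rightarrow> ('a, 'n) form11 \<Rightarrow> ('a \<Rightarrow> real)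
     \<Rightarrow> real \<Rightarrow> ('a \<Rightarrow> real) \<Rightarrow> bool" where
  "flow_exists A \<omega> chi F t \<phi>0 \<longleftrightarrow> (\<exists>\<phi>. flow_solution A \<omega> chi F {0..t} \<phi> \<and> \<phi> 0 = \<phi>0)"

definition const_rel ::
  "('a::t2_space, 'n::finite) chart set \<Rightarrow> ('a, 'n) form11 \<Rightarrow> (('a \<Rightarrow> real) \<times> ('a \<Rightarrow> real)) set" where
  "const_rel A chi = {(\<phi>, \<psi>). \<phi> \<in> potentials A chi \<and> \<psi> \<in> potentials A chi \<and>
                           (\<exists>a. \<forall>p. \<psi> p = \<phi> p + a)}"

definition potential_class ::
  "('a::t2_space, 'n::finite) chart set \<Rightarrow> ('a, 'n) form11 \<Rightarrow> ('a \<Rightarrow> real) \<Rightarrow> ('a \<Rightarrow> real) set" where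
  "potential_class A chi \<phi> = const_rel A chi `` {\<phi>}"

definition potentials_mod_const ::
  "('a::t2_space, 'n::finite) chart set \<Rightarrow> ('a, 'n) form11 \<Rightarrow> ('a \<Rightarrow> real) set set" where
  "potentials_mod_const A chi = potentials A chi // const_rel A chi"

definition osc :: "('a \<Rightarrow> real) \<Rightarrow> real" where
  "osc f = (SUP p. f p) - (INF p. f p)"

definition d_osc :: "('a \<Rightarrow> real) set \<Rightarrow> ('a \<Rightarrow> real) set \<Rightarrow> real" where
  "d_osc C D = (THE d. \<exists>\<phi>\<in>C. \<exists>\<psi>\<in>D. d = osc (\<lambda>p. \<phi> p - \<psi> p))"

definition flow_domain ::
  "('a::t2_space, 'n::finite) chart set \<Rightarrow> ('a, 'n) form11 \<Rightarrow> ('a, 'n) form11 \<Rightarrow> ('a \<Rightarrow> real)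
     \<Rightarrow> real \<Rightarrow> ('a \<Rightarrow> real) set set" where
  "flow_domain A \<omega> chi F t =
     {potential_class A chi \<phi>0 | \<phi>0. \<phi>0 \<in> potentials A chi \<and> flow_exists A \<omega> chi F t \<phi>0}"

definition flow_map ::
  "('a::t2_space, 'n::finite) chart set \<Rightarrow> ('a, 'n) form11 \<Rightarrow> ('a, 'n) form11 \<Rightarrow> ('a \<Rightarrow> real)
     \<Rightarrow> real \<Rightarrow> ('a \<Rightarrow> real) set \<Rightarrow> ('a \<Rightarrow> real) set" where
  "flow_map A \<omega> chi F t C =
     (THE D. \<exists>\<phi>. flow_solution A \<omega> chi F {0..t} \<phi> \<and> \<phi> 0 \<in> C \<and> D = potential_class A chi (\<phi> t))"

section \<open>Sanity checks\<close>

lemma equiv_const_rel: "equiv (potentials A chi) (const_rel A chi)"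
proof (rule equivI)
  show "const_rel A chi \<subseteq> potentials A chi \<times> potentials A chi"
    by (auto simp: const_rel_def)
  show "refl_on (potentials A chi) (const_rel A chi)"
    by (auto simp: refl_on_def const_rel_def intro: exI[of _ 0])
  show "sym (const_rel A chi)"
  proof (rule symI)
    fix \<phi> \<psi> assume "(\<phi>, \<psi>) \<in> const_rel A chi"
    then obtain a where "\<phi> \<in> potentials A chi" "\<psi> \<in> potentials A chi" "\<forall>p. \<psi> p = \<phi> p + a"
      by (auto simp: const_rel_def)
    then show "(\<psi>, \<phi>) \<in> const_rel A chi"
      by (auto simp: const_rel_def intro: exI[of _ "- a"])
  qed
  show "trans (const_rel A chi)"
  proof (rule transI)
    fix \<phi> \<psi> \<eta> assume "(\<phi>, \<psi>) \<in> const_rel A chi" "(\<psi>, \<eta>) \<in> const_rel A chi"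
    then obtain a b where "\<phi> \<in> potentials A chi" "\<eta> \<in> potentials A chi"
      "\<forall>p. \<psi> p = \<phi> p + a" "\<forall>p. \<eta> p = \<psi> p + b"
      by (auto simp: const_rel_def)
    then show "(\<phi>, \<eta>) \<in> const_rel A chi"
      by (auto simp: const_rel_def intro!: exI[of _ "a + b"])
  qed
qed

lemma smooth_on_imp_continuous_on:
  assumes "open S" "smooth_on S f"
  shows "continuous_on S f"
proof (rule continuous_at_imp_continuous_on, rule ballI)
  fix q assume "q \<in> S"
  then obtain W g where W: "open W" "q \<in> W" "\<forall>k. Ck_on k W g" "\<forall>y\<in>S \<inter> W. g y = f y"
    using assms(2) unfolding smooth_on_def by blast
  have "Ck_on 0 W g" using W(3) by blast
  then have "continuous_on (S \<inter> W) g" by (auto intro: continuous_on_subset)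
  then have "continuous_on (S \<inter> W) f" using W(4) continuous_on_cong[OF refl, of "S \<inter> W" g f] by simp
  then show "isCont f q"
    using assms(1) W(1,2) \<open>q \<in> S\<close> by (simp add: continuous_on_eq_continuous_at open_Int)
qed

lemma smooth_fun_imp_continuous:
  assumes A: "holomorphic_atlas A" and f: "smooth_fun A f"
  shows "continuous_on UNIV f"
proof (rule continuous_at_imp_continuous_on, rule ballI)
  fix p
  obtain c where c: "c \<in> A" "p \<in> fst c" using A unfolding holomorphic_atlas_def by blast
  have o: "open (fst c)" "open (chart_image c)"
    and h: "homeomorphism (fst c) (chart_image c) (snd c) (chart_inv c)"
    using A c(1) unfolding holomorphic_atlas_def by auto
  have "continuous_on (chart_image c) (f \<circ> chart_inv c)"
    using f c(1) unfolding smooth_fun_def by (blast intro: smooth_on_imp_continuous_on[OF o(2)])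
  then have "continuous_on (fst c) ((f \<circ> chart_inv c) \<circ> snd c)"
    using h by (intro continuous_on_compose[of "fst c" "snd c" "f \<circ> chart_inv c"])
      (simp_all add: homeomorphism_def del: o_apply)
  moreover have "((f \<circ> chart_inv c) \<circ> snd c) q = f q" if "q \<in> fst c" for q
    using h that by (auto simp: homeomorphism_def)
  ultimately have "continuous_on (fst c) f"
    using continuous_on_cong[OF refl, of "fst c" "(f \<circ> chart_inv c) \<circ> snd c" f] by blast
  then show "isCont f p" using o(1) c(2) by (simp add: continuous_on_eq_continuous_at)
qed

lemma osc_add_const:
  fixes f :: "'a \<Rightarrow> real"
  assumes "bdd_above (range f)" "bdd_below (range f)"
  shows "osc (\<lambda>p. f p + a) = osc f"
proof -
  have "(SUP p. f p + a) = (SUP p. f p) + a"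
    using continuous_at_Sup_mono[of "\<lambda>x. x + a" "range f"] assms(1)
    by (simp add: image_image mono_def continuous_intros)
  moreover have "(INF p. f p + a) = (INF p. f p) + a"
    using continuous_at_Inf_mono[of "\<lambda>x. x + a" "range f"] assms(2)
    by (simp add: image_image mono_def continuous_intros)
  ultimately show ?thesis by (simp add: osc_def)
qed

text \<open>The oscillation distance of two classes is computed by any representatives.\<close>

lemma d_osc_potential_class:
  fixes A :: "('a::t2_space, 'n::finite) chart set"
  assumes "compact (UNIV :: 'a set)" and A: "holomorphic_atlas A"
    and \<phi>: "\<phi> \<in> potentials A chi" and \<psi>: "\<psi> \<in> potentials A chi"
  shows "d_osc (potential_class A chi \<phi>) (potential_class A chi \<psi>) = osc (\<lambda>p. \<phi> p - \<psi> p)"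
  unfolding d_osc_def
proof (rule the_equality)
  have self: "\<phi> \<in> potential_class A chi \<phi>" "\<psi> \<in> potential_class A chi \<psi>"
    using \<phi> \<psi> by (auto simp: potential_class_def const_rel_def intro: exI[of _ 0])
  then show "\<exists>\<phi>'\<in>potential_class A chi \<phi>. \<exists>\<psi>'\<in>potential_class A chi \<psi>.
      osc (\<lambda>p. \<phi> p - \<psi> p) = osc (\<lambda>p. \<phi>' p - \<psi>' p)" by blast
  fix d assume "\<exists>\<phi>'\<in>potential_class A chi \<phi>. \<exists>\<psi>'\<in>potential_class A chi \<psi>. d = osc (\<lambda>p. \<phi>' p - \<psi>' p)"
  then obtain \<phi>' \<psi>' a b where d: "d = osc (\<lambda>p. \<phi>' p - \<psi>' p)"
    and "\<forall>p. \<phi>' p = \<phi> p + a" "\<forall>p. \<psi>' p = \<psi> p + b"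
    by (auto simp: potential_class_def const_rel_def)
  then have eq: "(\<lambda>p. \<phi>' p - \<psi>' p) = (\<lambda>p. (\<phi> p - \<psi> p) + (a - b))" by auto
  have "continuous_on UNIV (\<lambda>p. \<phi> p - \<psi> p)"
    using \<phi> \<psi> smooth_fun_imp_continuous[OF A] by (intro continuous_on_diff) (simp_all add: potentials_def)
  then have "bounded (range (\<lambda>p. \<phi> p - \<psi> p))"
    using assms(1) compact_continuous_image compact_imp_bounded by blast
  then show "d = osc (\<lambda>p. \<phi> p - \<psi> p)"
    unfolding d eq by (intro osc_add_const) (auto simp: bounded_imp_bdd_above bounded_imp_bdd_below)
qed

lemma wedge_power_eq_det:
  fixes G :: "complex^'n^'n"
  shows "wedge_power G = fact CARD('n) * det G"
proof -
  have "wedge_power G = (\<Sum>\<sigma> | \<sigma> permutes (UNIV::'n set). of_int (sign \<sigma>) * det (\<chi> i. G $ \<sigma> i))"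
    by (simp add: wedge_power_def wedge_top_def det_def sum_distrib_left mult.assoc)
  also have "\<dots> = (\<Sum>\<sigma> | \<sigma> permutes (UNIV::'n set). det G)"
    by (rule sum.cong)
      (auto simp: det_permute_rows sign_def)
  also have "\<dots> = fact CARD('n) * det G"
    by (simp add: card_permutations)
  finally show ?thesis .
qed

lemma sum_permutations_at:
  fixes f :: "'n::finite \<Rightarrow> complex" and k0 :: 'n
  shows "of_nat CARD('n) * (\<Sum>\<sigma> | \<sigma> permutes (UNIV::'n set). f (\<sigma> k0))
           = fact CARD('n) * (\<Sum>j\<in>UNIV. f j)"
proof -
  let ?P = "{\<sigma>. \<sigma> permutes (UNIV::'n set)}"
  have *: "(\<Sum>\<sigma>\<in>?P. f (\<sigma> k)) = (\<Sum>\<sigma>\<in>?P. f (\<sigma> k0))" for k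
    using sum_permutations_compose_right[of "Transposition.transpose k0 k" UNIV "\<lambda>\<sigma>. f (\<sigma> k)"]
    by (simp add: permutes_swap_id)
  have "of_nat CARD('n) * (\<Sum>\<sigma>\<in>?P. f (\<sigma> k0)) = (\<Sum>k\<in>UNIV. \<Sum>\<sigma>\<in>?P. f (\<sigma> k))"
    by (subst sum.cong[OF refl *]) simp_all
  also have "\<dots> = (\<Sum>\<sigma>\<in>?P. \<Sum>k\<in>UNIV. f (\<sigma> k))" by (rule sum.swap)
  also have "\<dots> = (\<Sum>\<sigma>\<in>?P. \<Sum>j\<in>UNIV. f j)"
    by (rule sum.cong[OF refl], rule sum.reindex_bij_betw) (auto simp: permutes_imp_bij)
  finally show ?thesis by (simp add: card_permutations)
qed

text \<open>The quotient \<open>\<chi>\<^sup>n / (\<omega> \<and> \<chi>\<^sup>n\<^sup>-\<^sup>1)\<close> is \<open>n\<close> divided by the trace of \<open>\<omega>\<close> with respect to \<open>\<chi>\<close>.\<close>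

lemma wedge_ratio_eq_trace:
  fixes W G :: "complex^'n^'n"
  assumes "invertible G"
  shows "wedge_power G / wedge_power1 W G = of_nat CARD('n) / trace (matrix_inv G ** W)"
proof -
  define k0 :: 'n where "k0 = (SOME k. True)"
  define H where "H = W ** matrix_inv G"
  let ?P = "{\<sigma>. \<sigma> permutes (UNIV::'n set)}"
  have "matrix_inv G ** G = mat 1"
    using someI_ex[OF assms[unfolded invertible_def]] by (simp add: matrix_inv_def)
  then have HG: "H ** G = W"
    by (simp add: H_def matrix_mul_assoc[symmetric])
  have row: "(\<Sum>i\<in>UNIV. H $ \<sigma> k0 $ \<sigma> i *s G $ \<sigma> i) = W $ \<sigma> k0" if "\<sigma> permutes UNIV" for \<sigma>
  proof -
    have "(\<Sum>i\<in>UNIV. H $ \<sigma> k0 $ \<sigma> i *s G $ \<sigma> i) = (\<Sum>j\<in>UNIV. H $ \<sigma> k0 $ j *s G $ j)"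
      using that by (intro sum.reindex_bij_betw) (auto simp: permutes_imp_bij)
    also have "\<dots> = W $ \<sigma> k0"
      unfolding HG[symmetric] by (simp add: vec_eq_iff matrix_matrix_mult_def)
    finally show ?thesis .
  qed
  have det: "det (\<chi> i. if i = k0 then W $ \<sigma> k0 else G $ \<sigma> i)
               = H $ \<sigma> k0 $ \<sigma> k0 * (of_int (sign \<sigma>) * det G)" if "\<sigma> permutes UNIV" for \<sigma>
  proof -
    have "(\<chi> i. if i = k0 then W $ \<sigma> k0 else G $ \<sigma> i) =
        (\<chi> i. if i = k0 then \<Sum>l\<in>UNIV. (\<chi> m. H $ \<sigma> k0 $ \<sigma> m) $ l *s row l (\<chi> m. G $ \<sigma> m)
              else row i (\<chi> m. G $ \<sigma> m))"
      using row[OF that] by (simp add: row_def vec_eq_iff)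
    then show ?thesis
      using that by (simp only: cramer_lemma_transpose det_permute_rows) simp
  qed
  have "wedge_power1 W G =
      (\<Sum>\<sigma>\<in>?P. of_int (sign \<sigma>) * det (\<chi> i. if i = k0 then W $ \<sigma> k0 else G $ \<sigma> i))"
    unfolding wedge_power1_def wedge_top_def det_def k0_def[symmetric] sum_distrib_left
    by (intro sum.cong refl) (auto simp: mult.assoc intro!: prod.cong)
  also have "\<dots> = (\<Sum>\<sigma>\<in>?P. H $ \<sigma> k0 $ \<sigma> k0) * det G"
    unfolding sum_distrib_right
    by (intro sum.cong refl) (auto simp: det sign_def)
  finally have "of_nat CARD('n) * wedge_power1 W G = fact CARD('n) * trace H * det G"
    using sum_permutations_at[of "\<lambda>j. H $ j $ j" k0] by (simp add: trace_def)
  then have "of_nat CARD('n) * wedge_power1 W G = trace H * wedge_power G"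
    by (simp add: wedge_power_eq_det)
  moreover have "trace H = trace (matrix_inv G ** W)"
    unfolding H_def by (rule trace_mul_sym)
  moreover have "wedge_power G \<noteq> 0"
    using assms by (simp add: wedge_power_eq_det invertible_det_nz)
  ultimately show ?thesis
    by (cases "trace H = 0") (auto simp: divide_simps)
qed

end

theory Submission
  imports Defs
begin

text \<open>The operator \<open>Q\<^sub>F\<close> is elliptic and unchanged when a constant is added to the potential, so
  translates of solutions are solutions, and everything reduces to the comparison principle: the maximum
  of the difference of two solutions \<open>\<phi>\<close> and \<open>\<psi>\<close> does not increase. At a spatial maximum of \<open>\<phi> - \<psi>\<close>
  the complex Hessian of the difference is nonpositive, hence \<open>\<chi>\<^sub>\<phi> \<le> \<chi>\<^sub>\<psi>\<close>, so the trace of \<open>\<omega>\<close> with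
  respect to \<open>\<chi>\<^sub>\<phi>\<close> is at least the one with respect to \<open>\<chi>\<^sub>\<psi>\<close>, and \<open>Q\<^sub>F(\<phi>) \<le> Q\<^sub>F(\<psi>)\<close> there. Subtracting
  \<open>\<epsilon> s\<close> makes this strict, so the maximum over space-time is attained at time \<open>0\<close>. Applying this to both
  differences bounds the oscillation; it also gives uniqueness up to constants.\<close>

section \<open>Positive definite Hermitian matrices\<close>

text \<open>The form \<open>x* G y\<close>, conjugate-linear in \<open>x\<close>. The sum in
  \<open>positive_form\<close> conjugates the other factor, so passing between the two replaces a
  vector by its entrywise conjugate.\<close>

definition hform :: "complex^'n^'n \<Rightarrow> complex^'n::finite \<Rightarrow> complex^'n \<Rightarrow> complex" where
  "hform G x y = (\<Sum>j\<in>UNIV. cnj (x $ j) * (G *v y) $ j)"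

definition hermitian_matrix :: "complex^'n^'n::finite \<Rightarrow> bool" where
  "hermitian_matrix G \<longleftrightarrow> (\<forall>j k. G $ k $ j = cnj (G $ j $ k))"

definition pos_semidef :: "complex^'n^'n::finite \<Rightarrow> bool" where
  "pos_semidef G \<longleftrightarrow> hermitian_matrix G \<and> (\<forall>x. 0 \<le> Re (hform G x x))"

definition pos_def :: "complex^'n^'n::finite \<Rightarrow> bool" where
  "pos_def G \<longleftrightarrow> hermitian_matrix G \<and> (\<forall>x. x \<noteq> 0 \<longrightarrow> 0 < Re (hform G x x))"

lemma hform_sum: "hform G x y = (\<Sum>j\<in>UNIV. \<Sum>k\<in>UNIV. G $ j $ k * cnj (x $ j) * y $ k)"
  by (simp add: hform_def matrix_vector_mult_def sum_distrib_left mult_ac)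

lemma hform_diff_right: "hform G x (y - z) = hform G x y - hform G x z"
  and hform_scale_right: "hform G x (c *s y) = c * hform G x y"
  and hform_diff_left: "hform G (y - z) x = hform G y x - hform G z x"
  and hform_scale_left: "hform G (c *s y) x = cnj c * hform G y x"
  and hform_diff_matrix: "hform (G - H) x y = hform G x y - hform H x y"
  by (simp_all add: hform_sum algebra_simps sum.distrib sum_subtractf sum_distrib_left)

lemma axis_nth_if: "axis k a $ i = (if i = k then a else 0)"
  by (simp add: axis_def)

lemma hform_axis: "hform G (axis j 1) (axis k 1) = G $ j $ k"
proof -
  have "cnj (axis j 1 $ i) * (G *v axis k 1) $ i = (if i = j then G $ j $ k else 0)" for i
    by (simp add: matrix_vector_mult_def axis_nth_if if_distrib[of "\<lambda>u. _ * u"] cong: if_cong)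
  then show ?thesis by (simp add: hform_def)
qed

lemma hermitian_matrixD: "hermitian_matrix G \<Longrightarrow> cnj (G $ j $ k) = G $ k $ j"
  unfolding hermitian_matrix_def by (metis complex_cnj_cnj)

lemma hermitian_matrix_add:
  assumes "hermitian_matrix G" "hermitian_matrix H"
  shows "hermitian_matrix (G + H)"
  unfolding hermitian_matrix_def by (simp add: assms hermitian_matrixD)

lemma hermitian_matrix_diff:
  assumes "hermitian_matrix G" "hermitian_matrix H"
  shows "hermitian_matrix (G - H)"
  unfolding hermitian_matrix_def by (simp add: assms hermitian_matrixD)

lemma hform_cnj:
  assumes "hermitian_matrix G"
  shows "cnj (hform G x y) = hform G y x"
proof -
  have "cnj (hform G x y) = (\<Sum>j\<in>UNIV. \<Sum>k\<in>UNIV. G $ k $ j * cnj (y $ k) * x $ j)"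
    unfolding hform_sum cnj_sum
    by (intro sum.cong refl) (simp add: hermitian_matrixD[OF assms] mult_ac)
  also have "\<dots> = hform G y x" unfolding hform_sum by (rule sum.swap)
  finally show ?thesis .
qed

lemma hform_self_real: "hermitian_matrix G \<Longrightarrow> Im (hform G x x) = 0"
  using hform_cnj[of G x x] by (simp add: complex_eq_iff)

lemma hform_zero [simp]: "hform G 0 x = 0" "hform G x 0 = 0"
  by (simp_all add: hform_def)

lemma pos_def_imp_semidef: "pos_def G \<Longrightarrow> pos_semidef G"
proof -
  assume G: "pos_def G"
  have "0 \<le> Re (hform G x x)" for x
    using G by (cases "x = 0") (simp_all add: pos_def_def less_imp_le)
  then show ?thesis using G by (simp add: pos_semidef_def pos_def_def)
qed

text \<open>A kernel vector \<open>x\<close> would satisfy \<open>hform G x x = 0\<close>.\<close>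

lemma pos_def_invertible:
  assumes "pos_def G"
  shows "invertible G"
proof -
  have "x = 0" if "G *v x = 0" for x
  proof (rule ccontr)
    assume "x \<noteq> 0"
    then have "0 < Re (hform G x x)" using assms by (simp add: pos_def_def)
    then show False using that by (simp add: hform_def)
  qed
  then show ?thesis
    by (simp add: invertible_left_inverse matrix_left_invertible_ker)
qed

lemma matrix_inv_mult_vector:
  assumes "invertible G"
  shows "G *v (matrix_inv G *v y) = y" "matrix_inv G *v (G *v y) = y"
  using someI_ex[OF assms[unfolded invertible_def]]
  by (simp_all add: matrix_inv_def matrix_vector_mul_assoc)

text \<open>Conjugate symmetry moves \<open>G\<close> onto \<open>matrix_inv G *v x\<close>, where
  it cancels the inverse; questions about the inverse thus become questions about \<open>G\<close>
  itself.\<close>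

lemma hform_matrix_inv:
  assumes "hermitian_matrix G" "invertible G"
  shows "hform (matrix_inv G) x y = hform G (matrix_inv G *v x) (matrix_inv G *v y)"
proof -
  let ?u = "matrix_inv G *v x" and ?v = "matrix_inv G *v y"
  have "hform G ?u ?v = cnj (hform G ?v ?u)" using assms(1) by (simp add: hform_cnj)
  also have "\<dots> = hform (matrix_inv G) x y"
    by (simp add: hform_def matrix_inv_mult_vector[OF assms(2)] mult.commute)
  finally show ?thesis by simp
qed

lemma pos_def_matrix_inv:
  assumes "pos_def G"
  shows "pos_def (matrix_inv G)"
proof -
  have G: "hermitian_matrix G" "invertible G"
    using assms pos_def_invertible by (auto simp: pos_def_def)
  have "hermitian_matrix (matrix_inv G)"
    unfolding hermitian_matrix_def hform_axis[symmetric] hform_matrix_inv[OF G] using G(1) by (simp add: hform_cnj)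
  moreover have "0 < Re (hform (matrix_inv G) x x)" if "x \<noteq> 0" for x
  proof -
    have "matrix_inv G *v x \<noteq> 0"
      using that matrix_inv_mult_vector(1)[OF G(2), of x] by auto
    then show ?thesis using assms by (simp add: hform_matrix_inv[OF G] pos_def_def)
  qed
  ultimately show ?thesis by (simp add: pos_def_def)
qed

text \<open>By duality \<open>y\<^sup>* G\<^sup>-\<^sup>1 y\<close> is the maximum of \<open>2 Re x\<^sup>* y - x\<^sup>* G x\<close>, which decreases in \<open>G\<close>.\<close>

lemma matrix_inv_antimono:
  assumes G: "pos_def G" and H: "pos_def H" and le: "pos_semidef (H - G)"
  shows "pos_semidef (matrix_inv G - matrix_inv H)"
proof -
  have inv: "hermitian_matrix G" "invertible G" "hermitian_matrix H" "invertible H"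
    using G H pos_def_invertible by (auto simp: pos_def_def)
  have "0 \<le> Re (hform (matrix_inv G - matrix_inv H) y y)" for y
  proof -
    \<comment> \<open>\<open>z\<close> and \<open>x\<close> are the maximisers of the dual
      expressions for \<open>G\<close> and for \<open>H\<close>. Since \<open>G *v z\<close> and
      \<open>H *v x\<close> both equal \<open>y\<close>, the cross terms in the
      \<open>G\<close>-form of \<open>x - z\<close> reduce to \<open>hform H x x\<close>.\<close>
    define x z where "x = matrix_inv H *v y" and "z = matrix_inv G *v y"
    have xz: "hform G x z = hform H x x"
      by (simp add: hform_def x_def z_def matrix_inv_mult_vector inv)
    moreover have "hform G z x = cnj (hform G x z)" using inv by (simp add: hform_cnj)
    ultimately have "Re (hform G (x - z) (x - z))
        = Re (hform G x x) - 2 * Re (hform H x x) + Re (hform G z z)"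
      by (simp add: hform_diff_left hform_diff_right)
    moreover have "0 \<le> Re (hform G (x - z) (x - z))"
      using pos_def_imp_semidef[OF G] by (simp add: pos_semidef_def)
    moreover have "0 \<le> Re (hform H x x) - Re (hform G x x)"
      using le hform_diff_matrix[of H G x x] by (metis minus_complex.sel(1) pos_semidef_def)
    ultimately have "Re (hform H x x) \<le> Re (hform G z z)" by linarith
    then show ?thesis
      by (simp add: hform_diff_matrix hform_matrix_inv inv x_def z_def)
  qed
  moreover have "hermitian_matrix (matrix_inv G - matrix_inv H)"
    using pos_def_matrix_inv[OF G] pos_def_matrix_inv[OF H]
    unfolding pos_def_def by (blast intro: hermitian_matrix_diff)
  ultimately show ?thesis
    by (simp add: pos_semidef_def)
qed

section \<open>Traces of products of positive matrices\<close>

text \<open>The size of a matrix is fixed by its index type, so a smaller block is modelled by a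
  full matrix vanishing outside \<open>S\<close>; this permits induction on
  \<open>S\<close>.\<close>

definition pos_def_supported :: "'n set \<Rightarrow> complex^'n^'n::finite \<Rightarrow> bool" where
  "pos_def_supported S W \<longleftrightarrow> hermitian_matrix W \<and> (\<forall>i j. i \<notin> S \<or> j \<notin> S \<longrightarrow> W $ i $ j = 0) \<and>
     (\<forall>x. x \<noteq> 0 \<longrightarrow> (\<forall>i. i \<notin> S \<longrightarrow> x $ i = 0) \<longrightarrow> 0 < Re (hform W x x))"

lemma trace_prod: "trace (P ** W) = (\<Sum>i\<in>UNIV. \<Sum>j\<in>UNIV. P $ i $ j * W $ j $ i)"
  by (simp add: trace_def matrix_matrix_mult_def)

text \<open>Splitting off a rank one summand leaves the Schur complement, which lives on fewer indices.\<close>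

lemma schur_step:
  assumes W: "pos_def_supported (insert k S) W" and k: "k \<notin> S"
  obtains W' w r where "pos_def_supported S W'" "w \<noteq> 0" "r > 0"
    "\<And>P. trace (P ** W) = trace (P ** W') + hform P w w / complex_of_real r"
proof -
  define W' where "W' = (\<chi> i j. W $ i $ j - W $ i $ k * W $ k $ j / W $ k $ k)"
  define w where "w = (\<chi> j. W $ j $ k)"
  define r where "r = Re (W $ k $ k)"
  have herm: "hermitian_matrix W"
    using W by (simp only: pos_def_supported_def)
  note sym = hermitian_matrixD[OF herm]
  have "0 < Re (hform W (axis k 1) (axis k 1))"
    using W by (simp add: pos_def_supported_def axis_eq_0_iff axis_nth_if)
  then have r: "0 < r" by (simp add: hform_axis r_def)
  have Wr: "W $ k $ k = of_real r"
    using hform_self_real[OF herm, of "axis k 1"] by (simp add: hform_axis r_def complex_eq_iff)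
  have w: "w \<noteq> 0" using Wr r by (auto simp: w_def vec_eq_iff intro!: exI[of _ k])
  have tr: "trace (P ** W) = trace (P ** W') + hform P w w / of_real r" for P
  proof -
    have "trace (P ** W') = trace (P ** W) -
        (\<Sum>i\<in>UNIV. \<Sum>j\<in>UNIV. P $ i $ j * (W $ j $ k * W $ k $ i / of_real r))"
      by (simp add: trace_prod W'_def Wr right_diff_distrib sum_subtractf)
    also have "(\<Sum>i\<in>UNIV. \<Sum>j\<in>UNIV. P $ i $ j * (W $ j $ k * W $ k $ i / of_real r))
        = hform P w w / of_real r"
      by (simp add: hform_sum w_def sum_divide_distrib sym mult_ac)
    finally show ?thesis by simp
  qed
  have herm': "hermitian_matrix W'"
    unfolding hermitian_matrix_def by (simp add: W'_def sym Wr mult.commute)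
  \<comment> \<open>Row and column \<open>k\<close> cancel because \<open>W $ k $ k\<close> is
    nonzero; at the other indices outside \<open>S\<close> every term was zero already.\<close>
  have supp': "W' $ i $ j = 0" if "i \<notin> S \<or> j \<notin> S" for i j
    using that W r by (cases "i = k"; cases "j = k") (auto simp: W'_def pos_def_supported_def Wr)
  have pos': "0 < Re (hform W' x x)" if x: "x \<noteq> 0" "\<forall>i. i \<notin> S \<longrightarrow> x $ i = 0" for x
  proof -
    \<comment> \<open>Completing the square: among the vectors \<open>x - c *s axis k 1\<close> the
      form of \<open>W\<close> is smallest at \<open>c = b / of_real r\<close>, and its value there
      is the form of the Schur complement at \<open>x\<close>.\<close>
    define b where "b = hform W (axis k 1) x"
    define c where "c = b / of_real r"
    define y where "y = x - c *s axis k 1"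
    have b: "b = (\<Sum>j\<in>UNIV. W $ k $ j * x $ j)"
    proof -
      have "cnj (axis k 1 $ i) * (W *v x) $ i = (if i = k then (W *v x) $ k else 0)" for i
        by (simp add: axis_nth_if)
      then show ?thesis by (simp add: b_def hform_def matrix_vector_mult_def)
    qed
    have b': "cnj b = (\<Sum>i\<in>UNIV. W $ i $ k * cnj (x $ i))"
      by (simp add: b sym)
    have "cnj b * b / of_real r
        = (\<Sum>i\<in>UNIV. \<Sum>j\<in>UNIV. W $ i $ k * W $ k $ j / of_real r * cnj (x $ i) * x $ j)"
      unfolding b' unfolding b sum_product sum_divide_distrib by (intro sum.cong refl) simp
    then have "hform W' x x = hform W x x - cnj b * b / of_real r"
      by (simp add: hform_sum W'_def Wr left_diff_distrib sum_subtractf)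
    also have "\<dots> = hform W y y"
    proof -
      have "hform W x (axis k 1) = cnj b" using herm by (simp add: b_def hform_cnj)
      then show ?thesis
        using r by (simp add: y_def hform_diff_left hform_diff_right hform_scale_left
            hform_scale_right hform_axis Wr b_def[symmetric] c_def algebra_simps)
    qed
    finally have eq: "hform W' x x = hform W y y" .
    \<comment> \<open>As \<open>k \<notin> S\<close>, \<open>x\<close> vanishes at \<open>k\<close>;
      it therefore has a nonzero entry elsewhere, which subtracting a multiple of
      \<open>axis k 1\<close> leaves alone.\<close>
    have "\<exists>i. i \<noteq> k \<and> x $ i \<noteq> 0" using x k by (metis vec_eq_iff zero_index)
    then have "y \<noteq> 0" by (auto simp: y_def vec_eq_iff axis_nth_if)
    moreover have "\<forall>i. i \<notin> insert k S \<longrightarrow> y $ i = 0"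
      using x(2) by (simp add: y_def axis_nth_if)
    ultimately show ?thesis using W eq by (simp add: pos_def_supported_def)
  qed
  have "pos_def_supported S W'"
    using herm' supp' pos' by (auto simp: pos_def_supported_def)
  from that[OF this w r tr] show ?thesis .
qed

text \<open>Induction on the support: each Schur step contributes \<open>hform P w w\<close> over a
  positive number, until nothing is left of \<open>W\<close>.\<close>

lemma trace_prod_nonneg_supported:
  assumes "finite S" "pos_def_supported S W" "pos_semidef P"
  shows "0 \<le> Re (trace (P ** W))"
  using assms
proof (induction S arbitrary: W rule: finite_induct)
  case empty
  then show ?case by (simp add: trace_prod pos_def_supported_def)
next
  case (insert k S)
  obtain W' w r where "pos_def_supported S W'" "r > 0"
    and tr: "trace (P ** W) = trace (P ** W') + hform P w w / complex_of_real r"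
    by (rule schur_step[OF insert.prems(1) insert.hyps(2)]) blast
  then have "0 \<le> Re (trace (P ** W'))" "0 \<le> Re (hform P w w / of_real r)"
    using insert.IH insert.prems by (auto simp: pos_semidef_def)
  then show ?case by (simp add: tr)
qed

lemma trace_prod_nonneg:
  assumes "pos_def W" "pos_semidef P"
  shows "0 \<le> Re (trace (P ** W))"
  using assms by (intro trace_prod_nonneg_supported[of UNIV]) (simp_all add: pos_def_def pos_def_supported_def)

text \<open>A single Schur step gives strictness: its rank one part contributes positively because
  \<open>w\<close> is nonzero and \<open>P\<close> definite, and the remainder is
  nonnegative.\<close>

lemma trace_prod_pos:
  assumes "pos_def W" "pos_def P"
  shows "0 < Re (trace (P ** W))"
proof -
  fix k :: 'a
  have "pos_def_supported (insert k (UNIV - {k})) W"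
    using assms(1) by (auto simp: pos_def_def pos_def_supported_def)
  then obtain W' w r where W': "pos_def_supported (UNIV - {k}) W'" "w \<noteq> 0" "r > 0"
    and tr: "trace (P ** W) = trace (P ** W') + hform P w w / complex_of_real r"
    by (rule schur_step) auto
  have "0 \<le> Re (trace (P ** W'))"
    using trace_prod_nonneg_supported[OF _ W'(1)] assms(2) by (simp add: pos_def_imp_semidef)
  moreover have "0 < Re (hform P w w / of_real r)"
    using W' assms(2) by (simp add: pos_def_def)
  ultimately show ?thesis by (simp add: tr)
qed

lemma trace_prod_real:
  assumes "hermitian_matrix P" "hermitian_matrix W"
  shows "Im (trace (P ** W)) = 0"
proof -
  have "cnj (trace (P ** W)) = (\<Sum>i\<in>UNIV. \<Sum>j\<in>UNIV. P $ j $ i * W $ i $ j)"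
    unfolding trace_prod cnj_sum
    by (intro sum.cong refl) (simp add: assms hermitian_matrixD)
  also have "\<dots> = trace (P ** W)" unfolding trace_prod by (rule sum.swap)
  finally show ?thesis by (simp add: complex_eq_iff)
qed

text \<open>By \<open>wedge_ratio_eq_trace\<close> the quotient is the dimension over the trace of
  the inverse times \<open>W\<close>. Inversion reverses the order and the trace against
  \<open>W\<close> preserves it, so passing from \<open>G\<close> to \<open>H\<close> does not
  increase the trace.\<close>

lemma log_wedge_ratio_mono:
  fixes W G H :: "complex^'n^'n::finite"
  assumes W: "pos_def W" and G: "pos_def G" and H: "pos_def H" and le: "pos_semidef (H - G)"
  shows "ln (Re (wedge_power G / wedge_power1 W G)) \<le> ln (Re (wedge_power H / wedge_power1 W H))"
proof -
  \<comment> \<open>The trace is real, hence so is the complex quotient; its positivity is what the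
    monotonicity of \<open>ln\<close> requires.\<close>
  have tr: "0 < Re (trace (matrix_inv K ** W))
      \<and> wedge_power K / wedge_power1 W K
          = of_real (real CARD('n) / Re (trace (matrix_inv K ** W)))" if "pos_def K" for K :: "complex^'n^'n"
  proof -
    define t where "t = Re (trace (matrix_inv K ** W))"
    have "Im (trace (matrix_inv K ** W)) = 0"
      using pos_def_matrix_inv[OF that] W unfolding pos_def_def by (blast intro: trace_prod_real)
    then have "trace (matrix_inv K ** W) = of_real t"
      by (simp add: complex_eq_iff t_def)
    then have "wedge_power K / wedge_power1 W K = of_real (real CARD('n) / t)"
      using wedge_ratio_eq_trace[OF pos_def_invertible[OF that], of W] by simp
    then show ?thesis
      using trace_prod_pos[OF W pos_def_matrix_inv[OF that]] by (simp add: t_def)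
  qed
  have "0 \<le> Re (trace ((matrix_inv G - matrix_inv H) ** W))"
    using W matrix_inv_antimono[OF G H le] by (rule trace_prod_nonneg)
  then have "Re (trace (matrix_inv H ** W)) \<le> Re (trace (matrix_inv G ** W))"
    by (simp add: trace_prod left_diff_distrib sum_subtractf)
  then show ?thesis
    using tr[OF G] tr[OF H] by (simp add: frac_le)
qed

section \<open>Second derivatives\<close>

text \<open>\<open>frechet_derivative\<close> is a choice among all derivatives, and both functions
  have the same ones, so the equality holds also where neither is differentiable.\<close>

lemma frechet_derivative_add_const:
  "frechet_derivative (\<lambda>x. f x + c) F = frechet_derivative f F"
proof -
  have "((\<lambda>x. f x + c) has_derivative D) F \<longleftrightarrow> (f has_derivative D) F" for D
    using has_derivative_add_const[of f D F c] has_derivative_add_const[of "\<lambda>x. f x + c" D F "- c"]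
    by auto
  then show ?thesis by (simp add: frechet_derivative_def)
qed

lemma differentiable_add_const:
  "(\<lambda>x. f x + c) differentiable F \<longleftrightarrow> f differentiable F"
  using differentiable_add[of f F "\<lambda>_. c"] differentiable_add[of "\<lambda>x. f x + c" F "\<lambda>_. - c"] by auto

lemma Ck_on_cong:
  assumes "open W" "Ck_on k W f" "\<And>x. x \<in> W \<Longrightarrow> f x = g x"
  shows "Ck_on k W g"
  using assms(2,3)
proof (induction k arbitrary: f g)
  case 0
  then show ?case using continuous_on_cong[OF refl, of W f g] by simp
next
  case (Suc k)
  have "g differentiable (at x)" if x: "x \<in> W" for x
  proof -
    obtain D where "(f has_derivative D) (at x)"
      using Suc.prems(1) x by (auto simp: differentiable_def)
    then have "(g has_derivative D) (at x)"
      by (rule has_derivative_transform_within_open[OF _ assms(1) x Suc.prems(2)])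
    then show ?thesis by (auto simp: differentiable_def)
  qed
  moreover have "Ck_on k W (\<lambda>x. frechet_derivative g (at x) v)" for v
  proof (rule Suc.IH)
    show "Ck_on k W (\<lambda>x. frechet_derivative f (at x) v)" using Suc.prems(1) by simp
    show "frechet_derivative f (at x) v = frechet_derivative g (at x) v" if "x \<in> W" for x
      using frechet_derivative_transform_within_open[of f x W g] Suc.prems assms(1) that by simp
  qed
  ultimately show ?case by simp
qed

text \<open>Differentiability and continuity are local, so neighbourhoods varying with the point
  suffice; the induction keeps them when passing to directional derivatives.\<close>

lemma Ck_on_local:
  assumes "\<And>q. q \<in> S \<Longrightarrow> \<exists>W. open W \<and> q \<in> W \<and> Ck_on k W f"
  shows "Ck_on k S f"
  using assms
proof (induction k arbitrary: f)
  case 0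
  then have "isCont f q" if "q \<in> S" for q
    using that by (metis Ck_on.simps(1) continuous_on_eq_continuous_at)
  then show ?case by (simp add: continuous_at_imp_continuous_on)
next
  case (Suc k)
  have "Ck_on k S (\<lambda>x. frechet_derivative f (at x) v)" for v
    using Suc.prems by (intro Suc.IH) (metis Ck_on.simps(2))
  moreover have "\<forall>x\<in>S. f differentiable (at x)" using Suc.prems by (metis Ck_on.simps(2))
  ultimately show ?case by simp
qed

lemma Ck_on_subset: "Ck_on k S f \<Longrightarrow> T \<subseteq> S \<Longrightarrow> Ck_on k T f"
  by (induction k arbitrary: f) (auto intro: continuous_on_subset)

lemma Ck_on_add_const: "Ck_on k S f \<Longrightarrow> Ck_on k S (\<lambda>x. f x + c)"
  by (cases k) (auto simp: frechet_derivative_add_const differentiable_add_const intro!: continuous_intros)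

text \<open>Each local extension coincides with \<open>f\<close> on the open set
  \<open>S \<inter> W\<close>, so \<open>f\<close> inherits its derivatives there.\<close>

lemma smooth_on_open_imp_Ck_on:
  assumes "open S" "smooth_on S f"
  shows "Ck_on k S f"
proof (rule Ck_on_local)
  fix q assume "q \<in> S"
  then obtain W g where W: "open W" "q \<in> W" "\<forall>k. Ck_on k W g" "\<forall>y\<in>S \<inter> W. g y = f y"
    using assms(2) unfolding smooth_on_def by blast
  have "Ck_on k (S \<inter> W) f"
    by (rule Ck_on_cong[of _ _ g]) (use W assms(1) in \<open>auto intro: Ck_on_subset\<close>)
  then show "\<exists>W. open W \<and> q \<in> W \<and> Ck_on k W f"
    using \<open>q \<in> S\<close> W(1,2) assms(1) by (intro exI[of _ "S \<inter> W"]) auto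
qed

lemma smooth_on_add_const:
  assumes "smooth_on S f"
  shows "smooth_on S (\<lambda>x. f x + c)"
  unfolding smooth_on_def
proof
  fix q assume "q \<in> S"
  then obtain W g where "open W" "q \<in> W" "\<forall>k. Ck_on k W g" "\<forall>y\<in>S \<inter> W. g y = f y"
    using assms unfolding smooth_on_def by blast
  then show "\<exists>W g. open W \<and> q \<in> W \<and> (\<forall>k. Ck_on k W g) \<and> (\<forall>y\<in>S \<inter> W. g y = f y + c)"
    by (intro exI[of _ W] exI[of _ "\<lambda>x. g x + c"]) (simp add: Ck_on_add_const)
qed

text \<open>Meant for sets such as \<open>{0..t} \<times> chart_image c\<close>, which are not open;
  continuity within the set is inherited from the local extension.\<close>

lemma smooth_on_continuous_on:
  assumes "smooth_on S f"
  shows "continuous_on S f"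
  unfolding continuous_on_eq_continuous_within
proof
  fix q assume q: "q \<in> S"
  then obtain W g where W: "open W" "q \<in> W" "\<forall>k. Ck_on k W g" "\<forall>y\<in>S \<inter> W. g y = f y"
    using assms unfolding smooth_on_def by blast
  have "continuous_on W g" using W(3) Ck_on.simps(1) by blast
  then have "continuous (at q within S) g"
    using W(1,2) by (simp add: continuous_at_imp_continuous_within continuous_on_eq_continuous_at)
  moreover have "eventually (\<lambda>y. y \<in> W) (at q within S)"
    using W(1,2) by (meson eventually_at_topological)
  then have "eventually (\<lambda>y. g y = f y) (at q within S)"
    using W(4) by (auto simp: eventually_at_filter elim!: eventually_mono)
  ultimately show "continuous (at q within S) f"
    using W(2,4) q unfolding continuous_within by (simp add: tendsto_cong)
qed

section \<open>The real Hessian: symmetry and comparison at a maximum\<close>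

definition hess :: "('e::real_normed_vector \<Rightarrow> real) \<Rightarrow> 'e \<Rightarrow> 'e \<Rightarrow> 'e \<Rightarrow> real" where
  "hess f z u v = frechet_derivative (\<lambda>x. frechet_derivative f (at x) v) (at z) u"

lemma Ck_on_2D:
  assumes "Ck_on 2 S f"
  shows "x \<in> S \<Longrightarrow> f differentiable (at x)"
    and "x \<in> S \<Longrightarrow> (\<lambda>y. frechet_derivative f (at y) v) differentiable (at x)"
    and "continuous_on S (\<lambda>y. hess f y u v)"
  using assms by (auto simp: numeral_2_eq_2 hess_def)

lemma has_derivative_along_line:
  fixes f :: "'e::real_normed_vector \<Rightarrow> real"
  assumes "f differentiable (at (a + s *\<^sub>R v))"
  shows "((\<lambda>s. f (a + s *\<^sub>R v)) has_real_derivative frechet_derivative f (at (a + s *\<^sub>R v)) v) (at s)"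
proof -
  let ?D = "frechet_derivative f (at (a + s *\<^sub>R v))"
  have D: "(f has_derivative ?D) (at (a + s *\<^sub>R v))" using assms by (simp add: frechet_derivative_works)
  have "((\<lambda>s. a + s *\<^sub>R v) has_derivative (\<lambda>h. h *\<^sub>R v)) (at s)"
    by (auto intro!: derivative_eq_intros)
  from has_derivative_compose[OF this D]
  have "((\<lambda>s. f (a + s *\<^sub>R v)) has_derivative (\<lambda>h. ?D (h *\<^sub>R v))) (at s)" .
  moreover have "(\<lambda>h. ?D (h *\<^sub>R v)) = (*) (?D v)"
    using linear_frechet_derivative[OF assms] by (auto simp: linear_cmul mult.commute)
  ultimately show ?thesis by (simp add: has_field_derivative_def)
qed

text \<open>Two mean value arguments: first along \<open>u\<close> for the increment
  \<open>g\<close> in direction \<open>v\<close>, then along \<open>v\<close> for the derivative in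
  direction \<open>u\<close>. The second difference is symmetric in \<open>u\<close> and
  \<open>v\<close>, which is what \<open>hess_symmetric\<close> exploits.\<close>

lemma second_difference_eq_hess:
  fixes f :: "'e::real_normed_vector \<Rightarrow> real"
  assumes f: "Ck_on 2 (ball z r) f" and h: "h > 0" "h * (norm u + norm v) < r"
  obtains w where "dist z w \<le> h * (norm u + norm v)"
    "f (z + h *\<^sub>R u + h *\<^sub>R v) - f (z + h *\<^sub>R u) - f (z + h *\<^sub>R v) + f z = h * (h * hess f w v u)"
proof -
  let ?D = "\<lambda>x. frechet_derivative f (at x) u"
  have near: "dist z (z + s *\<^sub>R u + q *\<^sub>R v) \<le> h * (norm u + norm v)"
    if "0 \<le> s" "s \<le> h" "0 \<le> q" "q \<le> h" for s q
  proof -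
    have "norm (s *\<^sub>R u + q *\<^sub>R v) \<le> h * norm u + h * norm v"
      using that by (intro order.trans[OF norm_triangle_ineq] add_mono) (auto intro: mult_right_mono)
    then show ?thesis
      by (simp add: dist_norm algebra_simps) (metis add.commute minus_add_distrib norm_minus_cancel uminus_add_conv_diff)
  qed
  then have ball: "z + s *\<^sub>R u + q *\<^sub>R v \<in> ball z r"
    if "0 \<le> s" "s \<le> h" "0 \<le> q" "q \<le> h" for s q
    using order.strict_trans1[OF near[OF that] h(2)] by simp
  define g where "g = (\<lambda>s. f ((z + h *\<^sub>R v) + s *\<^sub>R u) - f (z + s *\<^sub>R u))"
  have "\<exists>s>0. s < h \<and> g h - g 0 = (h - 0) * (?D ((z + h *\<^sub>R v) + s *\<^sub>R u) - ?D (z + s *\<^sub>R u))"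
  proof (rule MVT2[OF h(1)])
    fix s assume s: "0 \<le> s" "s \<le> h"
    have "f differentiable (at ((z + h *\<^sub>R v) + s *\<^sub>R u))" "f differentiable (at (z + s *\<^sub>R u))"
      using Ck_on_2D(1)[OF f ball[OF s, of h]] Ck_on_2D(1)[OF f ball[OF s, of 0]] h(1)
      by (simp_all add: algebra_simps)
    then show "(g has_real_derivative ?D ((z + h *\<^sub>R v) + s *\<^sub>R u) - ?D (z + s *\<^sub>R u)) (at s)"
      unfolding g_def by (intro DERIV_diff has_derivative_along_line)
  qed
  then obtain s where s: "0 < s" "s < h"
    and gs: "g h - g 0 = h * (?D (z + s *\<^sub>R u + h *\<^sub>R v) - ?D (z + s *\<^sub>R u))"
    by (auto simp: algebra_simps)
  define k where "k = (\<lambda>q. ?D ((z + s *\<^sub>R u) + q *\<^sub>R v))"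
  have "\<exists>q>0. q < h \<and> k h - k 0 = (h - 0) * hess f ((z + s *\<^sub>R u) + q *\<^sub>R v) v u"
  proof (rule MVT2[OF h(1)])
    fix q assume "0 \<le> q" "q \<le> h"
    then have "?D differentiable (at (z + s *\<^sub>R u + q *\<^sub>R v))"
      using s by (intro Ck_on_2D(2)[OF f] ball) auto
    then show "(k has_real_derivative hess f (z + s *\<^sub>R u + q *\<^sub>R v) v u) (at q)"
      unfolding k_def hess_def by (rule has_derivative_along_line)
  qed
  then obtain q where q: "0 < q" "q < h"
    and kq: "k h - k 0 = h * hess f (z + s *\<^sub>R u + q *\<^sub>R v) v u" by auto
  have "f (z + h *\<^sub>R u + h *\<^sub>R v) - f (z + h *\<^sub>R u) - f (z + h *\<^sub>R v) + f z
      = h * (h * hess f (z + s *\<^sub>R u + q *\<^sub>R v) v u)"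
    using gs kq by (simp add: g_def k_def algebra_simps)
  then show ?thesis using that near[of s q] s q by simp
qed

text \<open>Schwarz's theorem: one second difference equals \<open>h * h\<close> times the Hessian
  in either order, taken at points near \<open>z\<close>; continuity makes both values close to
  those at \<open>z\<close>.\<close>

lemma hess_symmetric:
  fixes f :: "'e::real_normed_vector \<Rightarrow> real"
  assumes "open S" "z \<in> S" and f: "Ck_on 2 S f"
  shows "hess f z u v = hess f z v u"
proof -
  have "\<bar>hess f z u v - hess f z v u\<bar> \<le> e" if "e > 0" for e
  proof -
    have "isCont (\<lambda>y. hess f y u v) z" "isCont (\<lambda>y. hess f y v u) z"
      using Ck_on_2D(3)[OF f] assms(1,2) continuous_on_eq_continuous_at by blast+
    moreover have "e / 2 > 0" using that by simp
    ultimately obtain d1 d2 where d: "d1 > 0" "\<And>y. dist y z < d1 \<Longrightarrow> dist (hess f y u v) (hess f z u v) < e / 2"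
      "d2 > 0" "\<And>y. dist y z < d2 \<Longrightarrow> dist (hess f y v u) (hess f z v u) < e / 2"
      unfolding continuous_at_eps_delta by blast
    obtain r where r: "r > 0" "ball z r \<subseteq> S" using assms(1,2) openE by blast
    define m where "m = min r (min d1 d2)"
    \<comment> \<open>This choice keeps the points \<open>w1\<close> and \<open>w2\<close> within
      distance \<open>m\<close> of \<open>z\<close>; the added \<open>1\<close> covers the case that
      both directions vanish.\<close>
    define h where "h = m / (norm u + norm v + 1)"
    have m: "m > 0" using d r by (simp add: m_def)
    then have h: "h > 0" unfolding h_def by (intro divide_pos_pos) (simp_all add: add_nonneg_pos)
    have hm: "h * (norm u + norm v) < m"
    proof -
      have "h * (norm u + norm v) < h * (norm u + norm v + 1)" using h by simp
      also have "\<dots> = m" unfolding h_def using norm_ge_zero[of u] norm_ge_zero[of v] by (simp add: add_nonneg_eq_0_iff)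
      finally show ?thesis .
    qed
    have fm: "Ck_on 2 (ball z m) f" using f r(2) by (rule_tac Ck_on_subset) (auto simp: m_def)
    obtain w1 where w1: "dist z w1 \<le> h * (norm u + norm v)"
      "f (z + h *\<^sub>R u + h *\<^sub>R v) - f (z + h *\<^sub>R u) - f (z + h *\<^sub>R v) + f z = h * (h * hess f w1 v u)"
      using second_difference_eq_hess[OF fm h hm] .
    obtain w2 where w2: "dist z w2 \<le> h * (norm v + norm u)"
      "f (z + h *\<^sub>R v + h *\<^sub>R u) - f (z + h *\<^sub>R v) - f (z + h *\<^sub>R u) + f z = h * (h * hess f w2 u v)"
      using second_difference_eq_hess[OF fm h, of v u] hm by (auto simp: add.commute)
    have "h * (h * hess f w1 v u) = h * (h * hess f w2 u v)"
      unfolding w1(2)[symmetric] w2(2)[symmetric] by (simp add: algebra_simps)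
    then have "hess f w1 v u = hess f w2 u v" using h by simp
    moreover have "dist w1 z < d2" "dist w2 z < d1"
      using w1(1) w2(1) hm by (auto simp: m_def dist_commute add.commute)
    ultimately have "\<bar>hess f w1 v u - hess f z u v\<bar> < e / 2" "\<bar>hess f w1 v u - hess f z v u\<bar> < e / 2"
      using d(2)[of w2] d(4)[of w1] by (simp_all add: dist_real_def)
    then show ?thesis by linarith
  qed
  then have "\<bar>hess f z u v - hess f z v u\<bar> \<le> 0" by (rule field_le_epsilon[of _ 0, simplified])
  then show ?thesis by simp
qed

text \<open>Linearity in \<open>u\<close> is that of a derivative; symmetry carries it over to
  \<open>v\<close>.\<close>

lemma hess_bilinear:
  assumes "open S" "z \<in> S" and f: "Ck_on 2 S f"
  shows "bilinear (hess f z)"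
  unfolding bilinear_def
proof (intro conjI allI)
  show *: "linear (\<lambda>u. hess f z u v)" for v
    unfolding hess_def using Ck_on_2D(2)[OF f assms(2)] by (rule linear_frechet_derivative)
  have "hess f z u = (\<lambda>v. hess f z v u)" for u
    by (rule ext) (rule hess_symmetric[OF assms])
  then show "linear (hess f z u)" for u
    using * by metis
qed

text \<open>Along the line through \<open>z\<close> the difference \<open>k\<close> has a critical
  point at \<open>0\<close>. A positive second derivative would make \<open>k'\<close> positive just
  to the right, and by the mean value theorem \<open>k\<close> would rise above its maximum.\<close>

lemma hess_le_at_max:
  fixes f g :: "'e::real_normed_vector \<Rightarrow> real"
  assumes S: "open S" "z \<in> S" and f: "Ck_on 2 S f" and g: "Ck_on 2 S g"
    and max: "\<And>x. x \<in> S \<Longrightarrow> f x - g x \<le> f z - g z"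
  shows "hess f z v v \<le> hess g z v v"
proof (rule ccontr)
  assume "\<not> ?thesis"
  then have pos: "0 < hess f z v v - hess g z v v" by simp
  obtain r where r: "r > 0" "ball z r \<subseteq> S" using S openE by blast
  define e where "e = r / (norm v + 1)"
  have e: "e > 0" using r(1) by (simp add: e_def add_nonneg_pos)
  have inS: "z + s *\<^sub>R v \<in> S" if "\<bar>s\<bar> < e" for s
  proof -
    have "norm (s *\<^sub>R v) \<le> \<bar>s\<bar> * (norm v + 1)" by (simp add: algebra_simps)
    also have "\<dots> < e * (norm v + 1)" using that by (intro mult_strict_right_mono) (auto simp: add_nonneg_pos)
    also have "\<dots> = r" unfolding e_def using norm_ge_zero[of v] by (simp add: add_nonneg_eq_0_iff)
    finally show ?thesis using r(2) by (auto simp: dist_norm)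
  qed
  define k where "k = (\<lambda>s. f (z + s *\<^sub>R v) - g (z + s *\<^sub>R v))"
  define k' where "k' = (\<lambda>s. frechet_derivative f (at (z + s *\<^sub>R v)) v - frechet_derivative g (at (z + s *\<^sub>R v)) v)"
  have k: "(k has_real_derivative k' s) (at s)" if "\<bar>s\<bar> < e" for s
    unfolding k_def k'_def
    using inS[OF that] by (intro DERIV_diff has_derivative_along_line Ck_on_2D(1)[OF f] Ck_on_2D(1)[OF g])
  \<comment> \<open>The summand \<open>0 *\<^sub>R v\<close> is kept so that the statement matches
    \<open>has_derivative_along_line\<close> at the parameter \<open>0\<close>.\<close>
  have k'': "(k' has_real_derivative hess f (z + 0 *\<^sub>R v) v v - hess g (z + 0 *\<^sub>R v) v v) (at 0)"
    unfolding k'_def hess_def using inS[of 0] e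
    by (intro DERIV_diff has_derivative_along_line Ck_on_2D(2)[OF f] Ck_on_2D(2)[OF g]) auto
  then obtain d where d: "d > 0" "\<And>h. 0 < h \<Longrightarrow> h < d \<Longrightarrow> k' 0 < k' h"
    using DERIV_pos_inc_right[OF k''] pos by auto
  have kmax: "k s \<le> k 0" if "\<bar>s\<bar> < e" for s
    using max[OF inS[OF that]] by (simp add: k_def)
  have "k' 0 = 0"
    using k[of 0] e kmax by (intro DERIV_local_max[of k _ 0 e]) auto
  define h where "h = min d e / 2"
  have h: "0 < h" "h < d" "h < e" using d(1) e by (auto simp: h_def)
  obtain s where s: "0 < s" "s < h" "k h - k 0 = (h - 0) * k' s"
    using MVT2[OF h(1), of k k'] k h by auto
  then have "0 < k' s" using d(2)[of s] h \<open>k' 0 = 0\<close> by simp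
  then have "0 < k h - k 0" unfolding s(3) using h(1) by simp
  then show False using kmax[of h] h by simp
qed

section \<open>From the real Hessian to the complex Hessian\<close>

text \<open>Adding the values at \<open>v\<close> and \<open>\<i> *s v\<close> retains only the part
  of type (1,1) of the quadratic form. For \<open>B\<close> the real Hessian, the coefficients are
  four times those produced by \<open>wirt\<close> and \<open>wirt_bar\<close>.\<close>

lemma bilinear_complex_vector:
  fixes B :: "complex^'n::finite \<Rightarrow> complex^'n \<Rightarrow> real"
  assumes B: "bilinear B"
  shows "B v v + B (\<i> *s v) (\<i> *s v) = Re (\<Sum>j\<in>UNIV. \<Sum>k\<in>UNIV.
     (of_real (B (axis j 1) (axis k 1) + B (axis j \<i>) (axis k \<i>))
        + \<i> * of_real (B (axis j 1) (axis k \<i>) - B (axis j \<i>) (axis k 1))) * v $ j * cnj (v $ k))"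
proof -
  \<comment> \<open>\<open>x j\<close> and \<open>y j\<close> are the parts of \<open>v\<close> and
    \<open>\<i> *s v\<close> in the complex coordinate line \<open>j\<close>: multiplication by
    \<open>\<i>\<close> sends \<open>axis j 1\<close> to \<open>axis j \<i>\<close> and
    \<open>axis j \<i>\<close> to \<open>- axis j 1\<close>.\<close>
  define x where "x = (\<lambda>j. Re (v $ j) *\<^sub>R axis j (1::complex) + Im (v $ j) *\<^sub>R axis j \<i>)"
  define y where "y = (\<lambda>j. Re (v $ j) *\<^sub>R axis j \<i> - Im (v $ j) *\<^sub>R axis j (1::complex))"
  have comp: "(\<Sum>j\<in>UNIV. f j) $ i = f i $ i" if "\<And>j. j \<noteq> i \<Longrightarrow> f j $ i = 0" for f :: "'n \<Rightarrow> complex^'n" and i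
    using that by (simp add: sum.remove[of UNIV i])
  have v: "v = (\<Sum>j\<in>UNIV. x j)"
    unfolding vec_eq_iff by (subst comp) (auto simp: x_def axis_def complex_eq_iff)
  have iv: "\<i> *s v = (\<Sum>j\<in>UNIV. y j)"
    unfolding vec_eq_iff by (subst comp) (auto simp: y_def axis_def complex_eq_iff)
  have "B v v + B (\<i> *s v) (\<i> *s v) = (\<Sum>j\<in>UNIV. \<Sum>k\<in>UNIV. B (x j) (x k) + B (y j) (y k))"
  proof -
    have "B (sum f UNIV) (sum f UNIV) = (\<Sum>j\<in>UNIV. \<Sum>k\<in>UNIV. B (f j) (f k))" for f
      by (simp add: bilinear_sum[OF B] sum.cartesian_product)
    from this[of x] this[of y] show ?thesis by (simp only: v[symmetric] iv[symmetric] sum.distrib)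
  qed
  also have "\<dots> = (\<Sum>j\<in>UNIV. \<Sum>k\<in>UNIV. Re (
     (of_real (B (axis j 1) (axis k 1) + B (axis j \<i>) (axis k \<i>))
        + \<i> * of_real (B (axis j 1) (axis k \<i>) - B (axis j \<i>) (axis k 1))) * v $ j * cnj (v $ k)))"
    by (intro sum.cong refl)
      (simp add: x_def y_def bilinear_ladd[OF B] bilinear_radd[OF B] bilinear_lmul[OF B] bilinear_rmul[OF B]
        bilinear_lsub[OF B] bilinear_rsub[OF B] algebra_simps)
  finally show ?thesis by simp
qed

lemma wirt_wirt_bar_of_real:
  fixes f :: "complex^'n::finite \<Rightarrow> real"
  assumes S: "open S" "z \<in> S" and f: "Ck_on 2 S f"
  shows "wirt j (wirt_bar k (\<lambda>z. complex_of_real (f z))) z =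
     (of_real (hess f z (axis j 1) (axis k 1) + hess f z (axis j \<i>) (axis k \<i>))
        + \<i> * of_real (hess f z (axis j 1) (axis k \<i>) - hess f z (axis j \<i>) (axis k 1))) / 4"
proof -
  define D where "D = (\<lambda>v x. frechet_derivative f (at x) v)"
  \<comment> \<open>\<open>g\<close> is the \<open>wirt_bar\<close> derivative written with real
    directional derivatives. Agreement on the open set \<open>S\<close> is enough to differentiate
    once more at \<open>z\<close>.\<close>
  define g where "g = (\<lambda>x. (complex_of_real (D (axis k 1) x) + \<i> * complex_of_real (D (axis k \<i>) x)) / 2)"
  have "frechet_derivative (\<lambda>z. complex_of_real (f z)) (at x) v = of_real (D v x)" if "x \<in> S" for x v
  proof -
    have "((\<lambda>z. complex_of_real (f z)) has_derivative (\<lambda>v. of_real (D v x))) (at x)"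
      using Ck_on_2D(1)[OF f that] unfolding D_def
      by (intro has_derivative_of_real) (simp add: frechet_derivative_works)
    from frechet_derivative_at[OF this] show ?thesis by metis
  qed
  then have wb: "g x = wirt_bar k (\<lambda>z. complex_of_real (f z)) x" if "x \<in> S" for x
    using that by (simp add: g_def wirt_bar_def)
  have "(D v has_derivative (\<lambda>u. hess f z u v)) (at z)" for v
    using Ck_on_2D(2)[OF f S(2), of v] unfolding D_def hess_def by (simp add: frechet_derivative_works)
  then have "(g has_derivative (\<lambda>u. (of_real (hess f z u (axis k 1)) + \<i> * of_real (hess f z u (axis k \<i>))) / 2)) (at z)"
    unfolding g_def by (auto intro!: derivative_eq_intros)
  then have "(wirt_bar k (\<lambda>z. complex_of_real (f z)) has_derivative
      (\<lambda>u. (of_real (hess f z u (axis k 1)) + \<i> * of_real (hess f z u (axis k \<i>))) / 2)) (at z)"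
    by (rule has_derivative_transform_within_open[OF _ S wb])
  then have *: "frechet_derivative (wirt_bar k (\<lambda>z. complex_of_real (f z))) (at z) =
      (\<lambda>u. (of_real (hess f z u (axis k 1)) + \<i> * of_real (hess f z u (axis k \<i>))) / 2)"
    by (rule frechet_derivative_at[symmetric])
  show ?thesis unfolding wirt_def * by (simp add: complex_eq_iff field_simps)
qed

section \<open>The comparison principle\<close>

lemma atlas_chart:
  assumes A: "holomorphic_atlas A" and c: "c \<in> A"
  shows "open (fst c)" "open (chart_image c)" "continuous_on (fst c) (snd c)"
    and "p \<in> fst c \<Longrightarrow> snd c p \<in> chart_image c"
    and "p \<in> fst c \<Longrightarrow> chart_inv c (snd c p) = p"
  using A c unfolding holomorphic_atlas_def homeomorphism_def by (auto simp: chart_image_def)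

lemma chart_function_C2:
  assumes A: "holomorphic_atlas A" and c: "c \<in> A" and \<phi>: "smooth_fun A \<phi>"
  shows "Ck_on 2 (chart_image c) (\<lambda>z. \<phi> (chart_inv c z))"
  using \<phi> c smooth_on_open_imp_Ck_on[OF atlas_chart(2)[OF A c]]
  by (fastforce simp: smooth_fun_def comp_def)

lemma i_ddbar_eq_hess:
  assumes A: "holomorphic_atlas A" and c: "c \<in> A" "p \<in> fst c" and \<phi>: "smooth_fun A \<phi>"
  defines "H \<equiv> hess (\<lambda>z. \<phi> (chart_inv c z)) (snd c p)"
  shows "i_ddbar \<phi> c p $ j $ k =
     (of_real (H (axis j 1) (axis k 1) + H (axis j \<i>) (axis k \<i>))
        + \<i> * of_real (H (axis j 1) (axis k \<i>) - H (axis j \<i>) (axis k 1))) / 4"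
  using wirt_wirt_bar_of_real[OF atlas_chart(2,4)[OF A c(1)] chart_function_C2[OF A c(1) \<phi>]] c(2)
  by (simp add: i_ddbar_def H_def)

text \<open>Symmetry of the real Hessian makes the real parts of the coefficients symmetric in
  \<open>j\<close> and \<open>k\<close> and the imaginary parts antisymmetric.\<close>

lemma hermitian_i_ddbar:
  assumes A: "holomorphic_atlas A" and c: "c \<in> A" "p \<in> fst c" and \<phi>: "smooth_fun A \<phi>"
  shows "hermitian_matrix (i_ddbar \<phi> c p)"
proof -
  let ?H = "hess (\<lambda>z. \<phi> (chart_inv c z)) (snd c p)"
  have sym: "?H u v = ?H v u" for u v
    using hess_symmetric[OF atlas_chart(2,4)[OF A c(1)] chart_function_C2[OF A c(1) \<phi>]] c(2) by simp
  show ?thesis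
    unfolding hermitian_matrix_def
  proof (intro allI)
    fix j k
    show "i_ddbar \<phi> c p $ k $ j = cnj (i_ddbar \<phi> c p $ j $ k)"
      using sym[of "axis k 1" "axis j 1"] sym[of "axis k \<i>" "axis j \<i>"]
        sym[of "axis k 1" "axis j \<i>"] sym[of "axis k \<i>" "axis j 1"]
      by (simp add: i_ddbar_eq_hess[OF assms] complex_eq_iff)
  qed
qed

text \<open>Reduces comparing complex Hessians to comparing real second derivatives along two
  directions. The conjugated vector reflects that \<open>hform\<close> conjugates its first
  argument.\<close>

lemma Re_hform_i_ddbar:
  assumes A: "holomorphic_atlas A" and c: "c \<in> A" "p \<in> fst c" and \<phi>: "smooth_fun A \<phi>"
  defines "H \<equiv> hess (\<lambda>z. \<phi> (chart_inv c z)) (snd c p)"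
  shows "Re (hform (i_ddbar \<phi> c p) x x) =
    (H (\<chi> j. cnj (x $ j)) (\<chi> j. cnj (x $ j)) + H (\<i> *s (\<chi> j. cnj (x $ j))) (\<i> *s (\<chi> j. cnj (x $ j)))) / 4"
proof -
  have "bilinear H"
    unfolding H_def
    using hess_bilinear[OF atlas_chart(2,4)[OF A c(1)] chart_function_C2[OF A c(1) \<phi>]] c(2) by simp
  note B = bilinear_complex_vector[OF this, of "\<chi> j. cnj (x $ j)"]
  have entry: "4 * i_ddbar \<phi> c p $ j $ k = of_real (H (axis j 1) (axis k 1) + H (axis j \<i>) (axis k \<i>))
        + \<i> * of_real (H (axis j 1) (axis k \<i>) - H (axis j \<i>) (axis k 1))" for j k
    by (simp add: i_ddbar_eq_hess[OF A c \<phi>] H_def)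
  have "4 * hform (i_ddbar \<phi> c p) x x = (\<Sum>j\<in>UNIV. \<Sum>k\<in>UNIV.
      (4 * i_ddbar \<phi> c p $ j $ k) * cnj (x $ j) * x $ k)"
    by (simp add: hform_sum sum_distrib_left mult_ac)
  also have "Re \<dots> = H (\<chi> j. cnj (x $ j)) (\<chi> j. cnj (x $ j)) + H (\<i> *s (\<chi> j. cnj (x $ j))) (\<i> *s (\<chi> j. cnj (x $ j)))"
    unfolding B entry by (simp only: vec_lambda_beta complex_cnj_cnj)
  finally show ?thesis by simp
qed

lemma pos_def_positive_form:
  assumes "positive_form A \<alpha>" "c \<in> A" "p \<in> fst c" "hermitian_matrix (\<alpha> c p)"
  shows "pos_def (\<alpha> c p)"
proof -
  have "0 < Re (hform (\<alpha> c p) x x)" if "x \<noteq> 0" for x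
  proof -
    have "(\<chi> j. cnj (x $ j)) \<noteq> 0" using that by (simp add: vec_eq_iff)
    then have "0 < Re (\<Sum>j\<in>UNIV. \<Sum>k\<in>UNIV. \<alpha> c p $ j $ k * (\<chi> j. cnj (x $ j)) $ j * cnj ((\<chi> j. cnj (x $ j)) $ k))"
      using assms(1-3) unfolding positive_form_def by blast
    then show ?thesis by (simp add: hform_sum)
  qed
  then show ?thesis using assms(4) by (simp add: pos_def_def)
qed

lemma hermitian_metric_pos_def:
  assumes "hermitian_metric A \<alpha>" "c \<in> A" "p \<in> fst c"
  shows "pos_def (\<alpha> c p)"
proof (rule pos_def_positive_form[OF _ assms(2,3)])
  show "positive_form A \<alpha>" using assms(1) by (simp add: hermitian_metric_def)
  show "hermitian_matrix (\<alpha> c p)"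
    using assms unfolding hermitian_metric_def real_11_form_def hermitian_matrix_def by blast
qed

text \<open>\<open>positive_form\<close> constrains real parts only; Hermitian symmetry comes
  separately, from \<open>chi\<close> and from the symmetry of the Hessian.\<close>

lemma potentials_pos_def:
  assumes A: "holomorphic_atlas A" and chi: "hermitian_metric A chi"
    and \<phi>: "\<phi> \<in> potentials A chi" and c: "c \<in> A" "p \<in> fst c"
  shows "pos_def (form_plus chi \<phi> c p)"
proof (rule pos_def_positive_form[OF _ c])
  show "positive_form A (form_plus chi \<phi>)" using \<phi> by (simp add: potentials_def)
  have "hermitian_matrix (i_ddbar \<phi> c p)" "hermitian_matrix (chi c p)"
    using hermitian_i_ddbar[OF A c] hermitian_metric_pos_def[OF chi c] \<phi>
    by (simp_all add: potentials_def pos_def_def)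
  then show "hermitian_matrix (form_plus chi \<phi> c p)"
    by (simp add: form_plus_def hermitian_matrix_add)
qed

text \<open>A maximum over the manifold is one over the chart image, so real second derivatives
  compare in every direction, and summing over two directions orders the complex Hessians. The
  common terms \<open>chi\<close> and \<open>F\<close> drop out.\<close>

lemma Q_op_le_at_max:
  assumes A: "holomorphic_atlas A" and \<omega>: "hermitian_metric A \<omega>" and chi: "hermitian_metric A chi"
    and \<phi>: "\<phi> \<in> potentials A chi" and \<psi>: "\<psi> \<in> potentials A chi" and c: "c \<in> A" "p \<in> fst c"
    and max: "\<And>q. \<phi> q - \<psi> q \<le> \<phi> p - \<psi> p"
  shows "Q_op \<omega> chi F \<phi> c p \<le> Q_op \<omega> chi F \<psi> c p"
proof -
  have s: "smooth_fun A \<phi>" "smooth_fun A \<psi>" using \<phi> \<psi> by (auto simp: potentials_def)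
  have "hess (\<lambda>z. \<phi> (chart_inv c z)) (snd c p) v v \<le> hess (\<lambda>z. \<psi> (chart_inv c z)) (snd c p) v v" for v
    by (rule hess_le_at_max[OF atlas_chart(2,4)[OF A c(1)]])
      (use c(2) max in \<open>auto simp: chart_function_C2[OF A c(1)] s atlas_chart(5)[OF A c(1)]\<close>)
  then have "Re (hform (i_ddbar \<phi> c p) x x) \<le> Re (hform (i_ddbar \<psi> c p) x x)" for x
    unfolding Re_hform_i_ddbar[OF A c s(1)] Re_hform_i_ddbar[OF A c s(2)]
    by (intro divide_right_mono add_mono) auto
  moreover have "hermitian_matrix (i_ddbar \<psi> c p - i_ddbar \<phi> c p)"
    using hermitian_i_ddbar[OF A c s(1)] hermitian_i_ddbar[OF A c s(2)]
    by (intro hermitian_matrix_diff)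
  ultimately have "pos_semidef (form_plus chi \<psi> c p - form_plus chi \<phi> c p)"
    by (simp add: pos_semidef_def form_plus_def hform_diff_matrix)
  then show ?thesis
    unfolding Q_op_def
    by (intro add_right_mono log_wedge_ratio_mono hermitian_metric_pos_def[OF \<omega> c]
        potentials_pos_def[OF A chi \<phi> c] potentials_pos_def[OF A chi \<psi> c])
qed

section \<open>The maximum principle in space-time\<close>

text \<open>Needed for a maximum over the compact set \<open>{0..t} \<times> UNIV\<close> to be
  attained; smoothness in time and space is given chart by chart.\<close>

lemma flow_solution_jointly_continuous:
  assumes A: "holomorphic_atlas A" and sol: "flow_solution A \<omega> chi F I \<phi>"
  shows "continuous_on (I \<times> UNIV) (\<lambda>(s, p). \<phi> s p)"
  unfolding continuous_on_eq_continuous_within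
proof
  fix x assume x: "x \<in> I \<times> (UNIV :: 'a set)"
  obtain c where c: "c \<in> A" "snd x \<in> fst c"
    using A unfolding holomorphic_atlas_def by blast
  have "continuous_on (I \<times> chart_image c) (\<lambda>(s, z). \<phi> s (chart_inv c z))"
    using sol c(1) unfolding flow_solution_def by (blast intro: smooth_on_continuous_on)
  moreover have "continuous_on (I \<times> fst c) (\<lambda>y. (fst y, snd c (snd y)))"
    by (intro continuous_intros continuous_on_compose2[OF atlas_chart(3)[OF A c(1)]]) auto
  ultimately have "continuous_on (I \<times> fst c)
      (\<lambda>y. (\<lambda>(s, z). \<phi> s (chart_inv c z)) (fst y, snd c (snd y)))"
    by (rule continuous_on_compose2) (auto simp: chart_image_def)
  then have "continuous_on (I \<times> fst c) (\<lambda>(s, p). \<phi> s p)"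
    by (rule continuous_on_eq) (auto simp: atlas_chart(5)[OF A c(1)])
  then have "continuous (at x within I \<times> fst c) (\<lambda>(s, p). \<phi> s p)"
    using x c(2) by (auto simp: continuous_on_eq_continuous_within)
  \<comment> \<open>The chart domain is open, so restricting the space variable to it does not
    affect continuity at \<open>x\<close>.\<close>
  moreover have "at x within I \<times> UNIV = at x within I \<times> fst c"
    using c(2) atlas_chart(1)[OF A c(1)] by (intro at_within_nhd[of x "UNIV \<times> fst c"]) (auto simp: open_Times mem_Times_iff)
  ultimately show "continuous (at x within I \<times> UNIV) (\<lambda>(s, p). \<phi> s p)" by simp
qed

lemma flow_comparison:
  fixes A :: "('a::t2_space, 'n::finite) chart set"
  assumes cpt: "compact (UNIV :: 'a set)" and A: "holomorphic_atlas A"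
    and \<omega>: "hermitian_metric A \<omega>" and chi: "hermitian_metric A chi"
    and \<phi>: "flow_solution A \<omega> chi F {0..t} \<phi>" and \<psi>: "flow_solution A \<omega> chi F {0..t} \<psi>"
    and init: "\<And>p. \<phi> 0 p - \<psi> 0 p \<le> m" and s: "s \<in> {0..t}"
  shows "\<phi> s p - \<psi> s p \<le> m"
proof (rule field_le_epsilon)
  fix e :: real assume "e > 0"
  \<comment> \<open>Scaled so that the correction \<open>\<epsilon> * s\<close> never exceeds
    \<open>e\<close>; the \<open>1\<close> keeps the denominator positive for
    \<open>t = 0\<close>.\<close>
  define \<epsilon> where "\<epsilon> = e / (t + 1)"
  have t: "0 \<le> t" using s by simp
  have \<epsilon>: "\<epsilon> > 0" using \<open>e > 0\<close> t by (simp add: \<epsilon>_def)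
  define v where "v = (\<lambda>(r, q). \<phi> r q - \<psi> r q - \<epsilon> * r)"
  have "continuous_on ({0..t} \<times> UNIV) v"
    using flow_solution_jointly_continuous[OF A \<phi>] flow_solution_jointly_continuous[OF A \<psi>]
    unfolding v_def case_prod_beta by (intro continuous_on_diff) (assumption | intro continuous_intros)+
  moreover have "compact ({0..t} \<times> (UNIV :: 'a set))" using cpt by (intro compact_Times) auto
  ultimately obtain s0 p0 where s0: "s0 \<in> {0..t}"
    and max: "\<And>r q. r \<in> {0..t} \<Longrightarrow> v (r, q) \<le> v (s0, p0)"
    using continuous_attains_sup[of "{0..t} \<times> (UNIV :: 'a set)" v] s by fastforce
  have "s0 = 0"
  proof (rule ccontr)
    assume "s0 \<noteq> 0"
    obtain c where c: "c \<in> A" "p0 \<in> fst c"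
      using A unfolding holomorphic_atlas_def by blast
    have "Q_op \<omega> chi F (\<phi> s0) c p0 \<le> Q_op \<omega> chi F (\<psi> s0) c p0"
    proof (rule Q_op_le_at_max[OF A \<omega> chi _ _ c])
      show "\<phi> s0 \<in> potentials A chi" "\<psi> s0 \<in> potentials A chi"
        using \<phi> \<psi> s0 by (auto simp: flow_solution_def)
      \<comment> \<open>At the fixed time \<open>s0\<close> the correction
        \<open>\<epsilon> * s0\<close> is the same at all points.\<close>
      show "\<phi> s0 q - \<psi> s0 q \<le> \<phi> s0 p0 - \<psi> s0 p0" for q
        using max[OF s0, of q] by (simp add: v_def)
    qed
    then have neg: "Q_op \<omega> chi F (\<phi> s0) c p0 - Q_op \<omega> chi F (\<psi> s0) c p0 - \<epsilon> < 0"
      using \<epsilon> by simp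
    have "((\<lambda>r. v (r, p0)) has_real_derivative
        Q_op \<omega> chi F (\<phi> s0) c p0 - Q_op \<omega> chi F (\<psi> s0) c p0 - \<epsilon>) (at s0 within {0..t})"
    proof -
      have "((\<lambda>r. \<phi> r p0) has_real_derivative Q_op \<omega> chi F (\<phi> s0) c p0) (at s0 within {0..t})"
        "((\<lambda>r. \<psi> r p0) has_real_derivative Q_op \<omega> chi F (\<psi> s0) c p0) (at s0 within {0..t})"
        using \<phi> \<psi> s0 c by (auto simp: flow_solution_def)
      then show ?thesis
        unfolding v_def prod.case by (auto intro!: derivative_eq_intros)
    qed
    \<comment> \<open>Only times before \<open>s0\<close> are examined, so the derivative within
      \<open>{0..t}\<close> suffices even if the maximum sits at the final time.\<close>
    from has_real_derivative_neg_dec_left[OF this neg]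
    obtain d where d: "d > 0" "\<And>h. 0 < h \<Longrightarrow> s0 - h \<in> {0..t} \<Longrightarrow> h < d \<Longrightarrow> v (s0, p0) < v (s0 - h, p0)"
      by blast
    \<comment> \<open>Halving \<open>d\<close> gives \<open>h < d\<close>, and the bound by
      \<open>s0\<close> keeps the earlier time nonnegative.\<close>
    define h where "h = min (d / 2) s0"
    have "0 < h" "s0 - h \<in> {0..t}" "h < d"
      using d(1) s0 \<open>s0 \<noteq> 0\<close> by (auto simp: h_def)
    then show False using d(2)[of h] max[of "s0 - h" p0] by force
  qed
  then have "v (s, p) \<le> m"
    using max[OF s, of p] init[of p0] by (simp add: v_def)
  then have "\<phi> s p - \<psi> s p \<le> m + \<epsilon> * s" by (simp add: v_def)
  also have "\<epsilon> * s \<le> \<epsilon> * (t + 1)" using \<epsilon> s by (intro mult_left_mono) auto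
  also have "\<epsilon> * (t + 1) = e" using t by (simp add: \<epsilon>_def)
  finally show "\<phi> s p - \<psi> s p \<le> m + e" by simp
qed

lemma potentials_diff_bounded:
  fixes A :: "('a::t2_space, 'n::finite) chart set"
  assumes "compact (UNIV :: 'a set)" "holomorphic_atlas A"
    and "\<phi> \<in> potentials A chi" "\<psi> \<in> potentials A chi"
  shows "bounded (range (\<lambda>p. \<phi> p - \<psi> p))"
proof -
  have "continuous_on UNIV (\<lambda>p. \<phi> p - \<psi> p)"
    using assms(3,4) smooth_fun_imp_continuous[OF assms(2)]
    by (intro continuous_on_diff) (simp_all add: potentials_def)
  then show ?thesis using assms(1) compact_continuous_image compact_imp_bounded by blast
qed

text \<open>Comparison is one-sided, so it is used twice: for the difference with its initial
  supremum, and for the reversed difference with minus the initial infimum.\<close>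

lemma flow_osc_nonincreasing:
  fixes A :: "('a::t2_space, 'n::finite) chart set"
  assumes cpt: "compact (UNIV :: 'a set)" and A: "holomorphic_atlas A"
    and \<omega>: "hermitian_metric A \<omega>" and chi: "hermitian_metric A chi"
    and \<phi>: "flow_solution A \<omega> chi F {0..t} \<phi>" and \<psi>: "flow_solution A \<omega> chi F {0..t} \<psi>"
    and t: "t \<ge> 0"
  shows "osc (\<lambda>p. \<phi> t p - \<psi> t p) \<le> osc (\<lambda>p. \<phi> 0 p - \<psi> 0 p)"
proof -
  \<comment> \<open>\<open>SUP\<close> and \<open>INF\<close> over the reals bound the values only
    when the range is bounded, which compactness provides.\<close>
  have "bounded (range (\<lambda>p. \<phi> 0 p - \<psi> 0 p))"
    using \<phi> \<psi> t by (intro potentials_diff_bounded[OF cpt A, of _ chi]) (auto simp: flow_solution_def)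
  then have bdd: "bdd_above (range (\<lambda>p. \<phi> 0 p - \<psi> 0 p))" "bdd_below (range (\<lambda>p. \<phi> 0 p - \<psi> 0 p))"
    by (auto simp: bounded_imp_bdd_above bounded_imp_bdd_below)
  have "\<phi> t p - \<psi> t p \<le> (SUP q. \<phi> 0 q - \<psi> 0 q)" for p
    by (rule flow_comparison[OF cpt A \<omega> chi \<phi> \<psi>]) (use t in \<open>auto intro: cSUP_upper bdd\<close>)
  moreover have "(INF q. \<phi> 0 q - \<psi> 0 q) \<le> \<phi> t p - \<psi> t p" for p
  proof -
    have "\<psi> 0 q - \<phi> 0 q \<le> - (INF q. \<phi> 0 q - \<psi> 0 q)" for q
      using cINF_lower[OF bdd(2), of q] by simp
    then have "\<psi> t p - \<phi> t p \<le> - (INF q. \<phi> 0 q - \<psi> 0 q)"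
      by (rule flow_comparison[OF cpt A \<omega> chi \<psi> \<phi>]) (use t in auto)
    then show ?thesis by simp
  qed
  ultimately show ?thesis
    unfolding osc_def by (intro diff_mono cSUP_least cINF_greatest) auto
qed

section \<open>Adding constants and passing to classes\<close>

lemma i_ddbar_add_const: "i_ddbar (\<lambda>p. \<phi> p + a) = i_ddbar \<phi>"
  by (intro ext) (simp add: i_ddbar_def wirt_bar_def[abs_def] frechet_derivative_add_const)

lemma form_plus_add_const: "form_plus chi (\<lambda>p. \<phi> p + a) = form_plus chi \<phi>"
  by (intro ext) (simp add: form_plus_def i_ddbar_add_const)

lemma potentials_add_const:
  assumes "\<phi> \<in> potentials A chi"
  shows "(\<lambda>p. \<phi> p + a) \<in> potentials A chi"
proof -
  have "smooth_fun A (\<lambda>p. \<phi> p + a)"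
    unfolding smooth_fun_def
  proof
    fix c assume "c \<in> A"
    then have "smooth_on (chart_image c) (\<lambda>z. (\<phi> \<circ> chart_inv c) z + a)"
      using assms unfolding potentials_def smooth_fun_def by (blast intro: smooth_on_add_const)
    then show "smooth_on (chart_image c) ((\<lambda>p. \<phi> p + a) \<circ> chart_inv c)" by (simp add: comp_def)
  qed
  then show ?thesis using assms by (simp add: potentials_def form_plus_add_const)
qed

text \<open>\<open>Q_op\<close> sees the potential only through \<open>form_plus\<close>, which
  constants leave unchanged, so a translate solves the same equation.\<close>

lemma flow_solution_add_const:
  assumes "flow_solution A \<omega> chi F I \<phi>"
  shows "flow_solution A \<omega> chi F I (\<lambda>s p. \<phi> s p + a)"
  unfolding flow_solution_def
proof (intro conjI ballI)
  fix c assume "c \<in> A"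
  then have "smooth_on (I \<times> chart_image c) (\<lambda>x. (\<lambda>(s, z). \<phi> s (chart_inv c z)) x + a)"
    using assms by (intro smooth_on_add_const) (simp add: flow_solution_def)
  then show "smooth_on (I \<times> chart_image c) (\<lambda>(s, z). \<phi> s (chart_inv c z) + a)"
    by (simp add: case_prod_unfold)
next
  fix s assume "s \<in> I"
  then show "(\<lambda>p. \<phi> s p + a) \<in> potentials A chi"
    using assms by (intro potentials_add_const) (simp add: flow_solution_def)
next
  fix s c p assume "s \<in> I" "c \<in> A" "p \<in> fst c"
  then have "((\<lambda>r. \<phi> r p) has_real_derivative Q_op \<omega> chi F (\<phi> s) c p) (at s within I)"
    using assms by (simp add: flow_solution_def)
  then show "((\<lambda>r. \<phi> r p + a) has_real_derivative Q_op \<omega> chi F (\<lambda>p. \<phi> s p + a) c p) (at s within I)"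
    by (auto simp: Q_op_def form_plus_add_const intro!: derivative_eq_intros)
qed

lemma potential_class_eq_iff:
  assumes "\<phi> \<in> potentials A chi" "\<psi> \<in> potentials A chi"
  shows "potential_class A chi \<phi> = potential_class A chi \<psi> \<longleftrightarrow> (\<exists>a. \<psi> = (\<lambda>p. \<phi> p + a))"
  unfolding potential_class_def using assms
  by (subst eq_equiv_class_iff[OF equiv_const_rel]) (auto simp: const_rel_def fun_eq_iff)

lemma flow_exists_add_const:
  assumes "flow_exists A \<omega> chi F t \<phi>0"
  shows "flow_exists A \<omega> chi F t (\<lambda>p. \<phi>0 p + a)"
proof -
  obtain \<phi> where "flow_solution A \<omega> chi F {0..t} \<phi>" "\<phi> 0 = \<phi>0"
    using assms unfolding flow_exists_def by blast
  then show ?thesis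
    unfolding flow_exists_def by (intro exI[of _ "\<lambda>s p. \<phi> s p + a"]) (simp add: flow_solution_add_const)
qed

lemma flow_solution_potentials:
  "flow_solution A \<omega> chi F I \<phi> \<Longrightarrow> s \<in> I \<Longrightarrow> \<phi> s \<in> potentials A chi"
  by (simp add: flow_solution_def)

text \<open>The initial difference is a constant \<open>a\<close>; comparison in both orders forces
  the difference at time \<open>t\<close> to be the same \<open>a\<close>.\<close>

lemma flow_solution_class_unique:
  fixes A :: "('a::t2_space, 'n::finite) chart set"
  assumes cpt: "compact (UNIV :: 'a set)" and A: "holomorphic_atlas A"
    and \<omega>: "hermitian_metric A \<omega>" and chi: "hermitian_metric A chi"
    and \<phi>: "flow_solution A \<omega> chi F {0..t} \<phi>" and \<psi>: "flow_solution A \<omega> chi F {0..t} \<psi>"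
    and t: "t \<ge> 0" and eq: "potential_class A chi (\<phi> 0) = potential_class A chi (\<psi> 0)"
  shows "potential_class A chi (\<phi> t) = potential_class A chi (\<psi> t)"
proof -
  have pot: "\<phi> s \<in> potentials A chi" "\<psi> s \<in> potentials A chi" if "s \<in> {0..t}" for s
    using \<phi> \<psi> that by (simp_all add: flow_solution_def)
  obtain a where a: "\<psi> 0 = (\<lambda>p. \<phi> 0 p + a)"
    using eq potential_class_eq_iff[OF pot[of 0]] t by auto
  have "\<psi> t p = \<phi> t p + a" for p
  proof (rule antisym)
    have "\<phi> t p - \<psi> t p \<le> - a"
      by (rule flow_comparison[OF cpt A \<omega> chi \<phi> \<psi>]) (use t in \<open>simp_all add: a\<close>)
    then show "\<phi> t p + a \<le> \<psi> t p" by simp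
    have "\<psi> t p - \<phi> t p \<le> a"
      by (rule flow_comparison[OF cpt A \<omega> chi \<psi> \<phi>]) (use t in \<open>simp_all add: a\<close>)
    then show "\<psi> t p \<le> \<phi> t p + a" by simp
  qed
  then have "\<psi> t = (\<lambda>p. \<phi> t p + a)" by blast
  then show ?thesis using potential_class_eq_iff[OF pot[of t]] t by auto
qed

text \<open>Justifies the definite description in \<open>flow_map\<close>: \<open>\<phi>\<close> is
  itself a witness, and any other solution starting in the class ends in the same class.\<close>

lemma flow_map_eq:
  fixes A :: "('a::t2_space, 'n::finite) chart set"
  assumes cpt: "compact (UNIV :: 'a set)" and A: "holomorphic_atlas A"
    and \<omega>: "hermitian_metric A \<omega>" and chi: "hermitian_metric A chi"
    and \<phi>: "flow_solution A \<omega> chi F {0..t} \<phi>" and t: "t \<ge> 0"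
  shows "flow_map A \<omega> chi F t (potential_class A chi (\<phi> 0)) = potential_class A chi (\<phi> t)"
  unfolding flow_map_def
proof (rule the_equality)
  have \<phi>0: "\<phi> 0 \<in> potentials A chi" using \<phi> t by (simp add: flow_solution_def)
  then have "\<phi> 0 \<in> potential_class A chi (\<phi> 0)"
    unfolding potential_class_def by (rule equiv_class_self[OF equiv_const_rel])
  then show "\<exists>\<psi>. flow_solution A \<omega> chi F {0..t} \<psi> \<and> \<psi> 0 \<in> potential_class A chi (\<phi> 0)
      \<and> potential_class A chi (\<phi> t) = potential_class A chi (\<psi> t)"
    using \<phi> by blast
  fix D assume "\<exists>\<psi>. flow_solution A \<omega> chi F {0..t} \<psi> \<and> \<psi> 0 \<in> potential_class A chi (\<phi> 0)
      \<and> D = potential_class A chi (\<psi> t)"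
  then obtain \<psi> where \<psi>: "flow_solution A \<omega> chi F {0..t} \<psi>"
    "\<psi> 0 \<in> potential_class A chi (\<phi> 0)" "D = potential_class A chi (\<psi> t)" by blast
  have "potential_class A chi (\<phi> 0) = potential_class A chi (\<psi> 0)"
    using \<psi>(2) equiv_class_eq[OF equiv_const_rel] by (fastforce simp: potential_class_def)
  from flow_solution_class_unique[OF cpt A \<omega> chi \<phi> \<psi>(1) t this] \<psi>(3)
  show "D = potential_class A chi (\<phi> t)" by simp
qed

theorem corollary3p3:
  fixes A :: "('a::t2_space, 'n::finite) chart set"
    and \<omega> chi :: "('a, 'n) form11"
    and F :: "'a \<Rightarrow> real"
    and t :: real
  assumes "compact (UNIV :: 'a set)" and "connected (UNIV :: 'a set)"
    and "holomorphic_atlas A" and "CARD('n) \<ge> 2"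
    and "hermitian_metric A \<omega>" and "hermitian_metric A chi"
    and "smooth_fun A F" and "t \<ge> 0"
  shows
    "(\<forall>\<phi>0\<in>potentials A chi. \<forall>\<psi>0\<in>potentials A chi.
        potential_class A chi \<phi>0 = potential_class A chi \<psi>0 \<longrightarrow>
        flow_exists A \<omega> chi F t \<phi>0 = flow_exists A \<omega> chi F t \<psi>0) \<and>
     (\<forall>\<phi> \<psi>. flow_solution A \<omega> chi F {0..t} \<phi> \<and> flow_solution A \<omega> chi F {0..t} \<psi> \<and>
        potential_class A chi (\<phi> 0) = potential_class A chi (\<psi> 0) \<longrightarrow>
        potential_class A chi (\<phi> t) = potential_class A chi (\<psi> t)) \<and>
     flow_map A \<omega> chi F t \<in> flow_domain A \<omega> chi F t \<rightarrow> potentials_mod_const A chi \<and>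
     (\<forall>\<phi>. flow_solution A \<omega> chi F {0..t} \<phi> \<longrightarrow>
        flow_map A \<omega> chi F t (potential_class A chi (\<phi> 0)) = potential_class A chi (\<phi> t)) \<and>
     (\<forall>C\<in>flow_domain A \<omega> chi F t. \<forall>D\<in>flow_domain A \<omega> chi F t.
        d_osc (flow_map A \<omega> chi F t C) (flow_map A \<omega> chi F t D) \<le> d_osc C D)"
proof -
  note cpt = assms(1) and A = assms(3) and \<omega> = assms(5) and chi = assms(6) and t = assms(8)
  note map_eq = flow_map_eq[OF cpt A \<omega> chi _ t]
  \<comment> \<open>Each class of the domain is represented by the initial value of an actual
    solution, which makes \<open>map_eq\<close> applicable.\<close>
  have dom: "\<exists>\<phi>. flow_solution A \<omega> chi F {0..t} \<phi> \<and> C = potential_class A chi (\<phi> 0)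
      \<and> \<phi> 0 \<in> potentials A chi \<and> \<phi> t \<in> potentials A chi" if C: "C \<in> flow_domain A \<omega> chi F t" for C
  proof -
    obtain \<phi> where \<phi>: "flow_solution A \<omega> chi F {0..t} \<phi>" "C = potential_class A chi (\<phi> 0)"
      using C unfolding flow_domain_def flow_exists_def by blast
    moreover have "\<phi> 0 \<in> potentials A chi" "\<phi> t \<in> potentials A chi"
      using t by (auto intro: flow_solution_potentials[OF \<phi>(1)])
    ultimately show ?thesis by blast
  qed
  have 1: "flow_exists A \<omega> chi F t \<phi>0 = flow_exists A \<omega> chi F t \<psi>0"
    if "\<phi>0 \<in> potentials A chi" "\<psi>0 \<in> potentials A chi"
      "potential_class A chi \<phi>0 = potential_class A chi \<psi>0" for \<phi>0 \<psi>0
  proof -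
    \<comment> \<open>Translation by a constant can be undone, so this implication used in both
      orders gives the equivalence.\<close>
    have "flow_exists A \<omega> chi F t v" if "flow_exists A \<omega> chi F t u" "\<exists>a. v = (\<lambda>p. u p + a)" for u v
      using that by (auto intro: flow_exists_add_const)
    then show ?thesis
      using that potential_class_eq_iff[OF that(1,2)] potential_class_eq_iff[OF that(2,1)] by blast
  qed
  have 3: "flow_map A \<omega> chi F t C \<in> potentials_mod_const A chi" if C: "C \<in> flow_domain A \<omega> chi F t" for C
  proof -
    obtain \<phi> where \<phi>: "flow_solution A \<omega> chi F {0..t} \<phi>" "C = potential_class A chi (\<phi> 0)"
      "\<phi> t \<in> potentials A chi" using dom[OF C] by blast
    show ?thesis
      unfolding \<phi>(2) map_eq[OF \<phi>(1)] unfolding potentials_mod_const_def potential_class_def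
      using \<phi>(3) by (rule quotientI)
  qed
  have 5: "d_osc (flow_map A \<omega> chi F t C) (flow_map A \<omega> chi F t D) \<le> d_osc C D"
    if CD: "C \<in> flow_domain A \<omega> chi F t" "D \<in> flow_domain A \<omega> chi F t" for C D
  proof -
    obtain \<phi> where \<phi>: "flow_solution A \<omega> chi F {0..t} \<phi>" "C = potential_class A chi (\<phi> 0)"
      "\<phi> 0 \<in> potentials A chi" "\<phi> t \<in> potentials A chi" using dom[OF CD(1)] by blast
    obtain \<psi> where \<psi>: "flow_solution A \<omega> chi F {0..t} \<psi>" "D = potential_class A chi (\<psi> 0)"
      "\<psi> 0 \<in> potentials A chi" "\<psi> t \<in> potentials A chi" using dom[OF CD(2)] by blast
    \<comment> \<open>Both distances become oscillations of differences of representatives, at time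
      \<open>t\<close> and at time \<open>0\<close>.\<close>
    show ?thesis
      unfolding \<phi>(2) \<psi>(2) map_eq[OF \<phi>(1)] map_eq[OF \<psi>(1)]
        d_osc_potential_class[OF cpt A \<phi>(3) \<psi>(3)] d_osc_potential_class[OF cpt A \<phi>(4) \<psi>(4)]
      by (rule flow_osc_nonincreasing[OF cpt A \<omega> chi \<phi>(1) \<psi>(1) t])
  qed
  have 2: "potential_class A chi (\<phi> t) = potential_class A chi (\<psi> t)"
    if "flow_solution A \<omega> chi F {0..t} \<phi> \<and> flow_solution A \<omega> chi F {0..t} \<psi> \<and>
      potential_class A chi (\<phi> 0) = potential_class A chi (\<psi> 0)" for \<phi> \<psi>
    using that by (elim conjE) (rule flow_solution_class_unique[OF cpt A \<omega> chi _ _ t])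
  have 4: "flow_map A \<omega> chi F t \<in> flow_domain A \<omega> chi F t \<rightarrow> potentials_mod_const A chi"
    using 3 by (rule Pi_I)
  show ?thesis
    by (intro conjI 4) (intro ballI allI impI; rule 1 2 map_eq 5; assumption)+
qed

end
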